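(* Let $\mathcal{A}=\mathbb{C}\text{-}\mathrm{span}\{\mathsf{e}_\alpha\}_{\alpha\in I}$ be a complex algebra with vector space basis $\{\mathsf{e}_\alpha\}_{\alpha\in I}$ indexed by a countably infinite set $I$, and assume $\mathcal{A}_{\mathrm{nice}}=\mathcal{A}$, i.e. $\|a\|_{m,\ell,\gamma}<+\infty$ for all $a\in\mathcal{A}$, $m\in\mathbb{N}_0$, $0\le\ell\le 2^m-1$, $\gamma\in I$. Endow $\mathcal{A}$ with the locally convex topology defined by all the seminorms $\|\cdot\|_{m,\ell,\gamma}$. Then: (i) The completion $\widehat{\mathcal{A}}$ of $\mathcal{A}$ is a Fréchet algebra. The underlying Fréchet space is explicitly $$\widehat{\mathcal{A}}=\Big\{a=\sum_{\alpha\in I}a_\alpha\mathsf{e}_\alpha\in\prod_{\alpha\in I}\mathbb{C}\mathsf{e}_\alpha \;\Big|\; \|a\|_{m,\ell,\gamma}<+\infty \text{ for all } m\in\mathbb{N}_0,\ \ell=0,\dots,2^m-1,\ \gamma\in I\Big\},$$ viewed as a subspace of the vector space $\prod_{\alpha\in I}\mathbb{C}\mathsf{e}_\alpha$ (with the topology defined by the seminorms $\|\cdot\|_{m,\ell,\gamma}$). The topology of $\widehat{\mathcal{A}}$ is finer than the Cartesian product topology of $\prod_{\alpha\in I}\mathbb{C}\mathsf{e}_\alpha$. (ii) The coefficient functionals $e^\alpha\colon a\mapsto a_\alpha$ extend to continuous linear functionals $e^\alpha\colon\widehat{\mathcal{A}}\to\mathbb{C}$. (iii) The vectors $\{\mathsf{e}_\alpha\}_{\alpha\in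 I}$ form an unconditional Schauder basis of $\widehat{\mathcal{A}}$, i.e. $a=\sum_{\alpha\in I}e^\alpha(a)\,\mathsf{e}_\alpha$ converges unconditionally for all $a\in\widehat{\mathcal{A}}$.
   Context: An algebra here is a complex vector space with a bilinear product $\star$ (associativity is not needed). Structure constants $C^\gamma_{\alpha\beta}$ are defined by $\mathsf{e}_\alpha\star\mathsf{e}_\beta=\sum_{\gamma\in I}C^\gamma_{\alpha\beta}\mathsf{e}_\gamma$ (for given $\alpha,\beta$ only finitely many are nonzero). For a formal series $a=\sum_\alpha a_\alpha\mathsf{e}_\alpha\in\prod_{\alpha\in I}\mathbb{C}\mathsf{e}_\alpha$ (in particular for $a\in\mathcal{A}$) define recursively, with values in $[0,+\infty]$ and the convention $0\cdot\infty=0$, for $m\in\mathbb{N}_0$, $\ell=0,\dots,2^m-1$, $\gamma\in I$: $$h_{0,0,\gamma}(a)=|a_\gamma|,\qquad h_{m+1,2\ell,\gamma}(a)=\sum_{\alpha\in I}\big(h_{m,\ell,\alpha}(a)\big)^2\sum_{\beta\in I}|C^\gamma_{\alpha\beta}|,\qquad h_{m+1,2\ell+1,\gamma}(a)=\sum_{\beta\in I}\big(h_{m,\ell,\beta}(a)\big)^2\sum_{\alpha\in I}|C^\gamma_{\alpha\beta}|,$$ and $\|a\|_{m,\ell,\gamma}=\big(h_{m,\ell,\gamma}(a)\big)^{1/2^m}$. On elements where they are finite these are seminorms. A Fréchet algebra is a Fréchet space with a (jointly) continuous bilinear product; it is not required to be locally multiplicatively convex. *)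

theory Defs
  imports "HOL-Analysis.Analysis" "HOL-Library.Function_Algebras"
begin

section \<open>Topological vector spaces on a carrier\<close>

text \<open>The carrier of a topological vector space is the \<^const>\<open>topspace\<close> of its topology, a linear
  subspace of an ambient complex vector space with scalar multiplication \<open>s\<close>.\<close>

definition linear_on ::
    "(complex \<Rightarrow> 'v \<Rightarrow> 'v) \<Rightarrow> (complex \<Rightarrow> 'w \<Rightarrow> 'w) \<Rightarrow> 'v::ab_group_add set \<Rightarrow> ('v \<Rightarrow> 'w::ab_group_add) \<Rightarrow> bool" where
  "linear_on s1 s2 V f \<longleftrightarrow>
     (\<forall>x\<in>V. \<forall>y\<in>V. f (x + y) = f x + f y) \<and> (\<forall>c. \<forall>x\<in>V. f (s1 c x) = s2 c (f x))"

definition bilinear_product_on ::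
    "(complex \<Rightarrow> 'v \<Rightarrow> 'v) \<Rightarrow> 'v::ab_group_add set \<Rightarrow> ('v \<Rightarrow> 'v \<Rightarrow> 'v) \<Rightarrow> bool" where
  "bilinear_product_on s V f \<longleftrightarrow>
     (\<forall>x\<in>V. \<forall>y\<in>V. f x y \<in> V) \<and>
     (\<forall>x\<in>V. linear_on s s V (\<lambda>y. f x y)) \<and> (\<forall>y\<in>V. linear_on s s V (\<lambda>x. f x y))"

definition topological_vector_space ::
    "(complex \<Rightarrow> 'v \<Rightarrow> 'v) \<Rightarrow> 'v::ab_group_add topology \<Rightarrow> bool" where
  "topological_vector_space s T \<longleftrightarrow>
     vector_space s \<and> module.subspace s (topspace T) \<and>
     continuous_map (prod_topology T T) T (\<lambda>(x, y). x + y) \<and>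
     continuous_map (prod_topology euclidean T) T (\<lambda>(c, x). s c x)"

definition locally_convex :: "(complex \<Rightarrow> 'v \<Rightarrow> 'v) \<Rightarrow> 'v::ab_group_add topology \<Rightarrow> bool" where
  "locally_convex s T \<longleftrightarrow>
     (\<forall>U. openin T U \<and> 0 \<in> U \<longrightarrow>
       (\<exists>W. openin T W \<and> 0 \<in> W \<and> W \<subseteq> U \<and>
         (\<forall>x\<in>W. \<forall>y\<in>W. \<forall>t\<in>{0..1}. s (of_real (1 - t)) x + s (of_real t) y \<in> W)))"

definition cauchy_filter_in :: "'v::ab_group_add topology \<Rightarrow> 'v filter \<Rightarrow> bool" where
  "cauchy_filter_in T F \<longleftrightarrow>
     F \<noteq> bot \<and> F \<le> principal (topspace T) \<and>
     (\<forall>U. openin T U \<and> 0 \<in> U \<longrightarrow>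
       (\<exists>S. eventually (\<lambda>x. x \<in> S) F \<and> (\<forall>x\<in>S. \<forall>y\<in>S. x - y \<in> U)))"

definition complete_in :: "'v::ab_group_add topology \<Rightarrow> bool" where
  "complete_in T \<longleftrightarrow> (\<forall>F. cauchy_filter_in T F \<longrightarrow> (\<exists>l. limitin T (\<lambda>x. x) l F))"

definition frechet_space :: "(complex \<Rightarrow> 'v \<Rightarrow> 'v) \<Rightarrow> 'v::ab_group_add topology \<Rightarrow> bool" where
  "frechet_space s T \<longleftrightarrow>
     topological_vector_space s T \<and> locally_convex s T \<and> metrizable_space T \<and> complete_in T"

definition frechet_algebra ::
    "(complex \<Rightarrow> 'v \<Rightarrow> 'v) \<Rightarrow> 'v::ab_group_add topology \<Rightarrow> ('v \<Rightarrow> 'v \<Rightarrow> 'v) \<Rightarrow> bool" where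
  "frechet_algebra s T f \<longleftrightarrow>
     frechet_space s T \<and> bilinear_product_on s (topspace T) f \<and>
     continuous_map (prod_topology T T) T (\<lambda>(x, y). f x y)"

text \<open>\<open>(s2, T2)\<close> is a (Hausdorff) completion of \<open>(s1, T1)\<close> via the embedding \<open>\<iota>\<close>.\<close>

definition is_completion ::
    "(complex \<Rightarrow> 'v \<Rightarrow> 'v) \<Rightarrow> 'v::ab_group_add topology \<Rightarrow>
     (complex \<Rightarrow> 'w \<Rightarrow> 'w) \<Rightarrow> 'w::ab_group_add topology \<Rightarrow> ('v \<Rightarrow> 'w) \<Rightarrow> bool" where
  "is_completion s1 T1 s2 T2 \<iota> \<longleftrightarrow>
     topological_vector_space s1 T1 \<and>
     topological_vector_space s2 T2 \<and> Hausdorff_space T2 \<and> complete_in T2 \<and>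
     linear_on s1 s2 (topspace T1) \<iota> \<and> embedding_map T1 T2 \<iota> \<and>
     T2 closure_of (\<iota> ` topspace T1) = topspace T2"

definition seminorm_topology :: "'v::ab_group_add set \<Rightarrow> ('v \<Rightarrow> real) set \<Rightarrow> 'v topology" where
  "seminorm_topology V P =
     topology_generated_by {{y \<in> V. p (y - x) < \<epsilon>} | p x \<epsilon>. p \<in> P \<and> x \<in> V \<and> \<epsilon> > 0}"

definition schauder_basis ::
    "(complex \<Rightarrow> 'v \<Rightarrow> 'v) \<Rightarrow> 'v::ab_group_add topology \<Rightarrow> (nat \<Rightarrow> 'v) \<Rightarrow> bool" where
  "schauder_basis s T b \<longleftrightarrow>
     range b \<subseteq> topspace T \<and>
     (\<forall>a\<in>topspace T. \<exists>!c::nat \<Rightarrow> complex.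
        limitin T (\<lambda>n. \<Sum>k<n. s (c k) (b k)) a sequentially)"

text \<open>Convergence of the net of finite partial sums; the analogue of \<^const>\<open>has_sum\<close> for a topology
  that does not come from a type class.\<close>

definition converges_unconditionally ::
    "'v::ab_group_add topology \<Rightarrow> ('i \<Rightarrow> 'v) \<Rightarrow> 'v \<Rightarrow> bool" where
  "converges_unconditionally T f a \<longleftrightarrow> limitin T (\<lambda>F. \<Sum>\<alpha>\<in>F. f \<alpha>) a (finite_subsets_at_top UNIV)"

text \<open>The index type carries no order, so a countably infinite family is required to be a Schauder
  basis in every enumeration.\<close>

definition unconditional_schauder_basis ::
    "(complex \<Rightarrow> 'v \<Rightarrow> 'v) \<Rightarrow> 'v::ab_group_add topology \<Rightarrow> ('i \<Rightarrow> 'v) \<Rightarrow> bool" where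
  "unconditional_schauder_basis s T b \<longleftrightarrow>
     (\<forall>\<sigma> :: nat \<Rightarrow> 'i. bij \<sigma> \<longrightarrow> schauder_basis s T (\<lambda>n. b (\<sigma> n))) \<and>
     (\<forall>a\<in>topspace T. \<exists>c. converges_unconditionally T (\<lambda>\<alpha>. s (c \<alpha>) (b \<alpha>)) a)"

section \<open>Algebras with a distinguished basis\<close>

definition basis_family :: "(complex \<Rightarrow> 'a \<Rightarrow> 'a) \<Rightarrow> ('i \<Rightarrow> 'a::ab_group_add) \<Rightarrow> bool" where
  "basis_family s e \<longleftrightarrow>
     inj e \<and> \<not> module.dependent s (range e) \<and> module.span s (range e) = UNIV"

definition basis_coeff :: "(complex \<Rightarrow> 'a \<Rightarrow> 'a) \<Rightarrow> ('i \<Rightarrow> 'a::ab_group_add) \<Rightarrow> 'i \<Rightarrow> 'a \<Rightarrow> complex" where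
  "basis_coeff s e \<alpha> x = module.representation s (range e) x (e \<alpha>)"

definition struct_const ::
    "(complex \<Rightarrow> 'a \<Rightarrow> 'a) \<Rightarrow> ('a \<Rightarrow> 'a \<Rightarrow> 'a) \<Rightarrow> ('i \<Rightarrow> 'a::ab_group_add) \<Rightarrow> 'i \<Rightarrow> 'i \<Rightarrow> 'i \<Rightarrow> complex" where
  "struct_const s star e \<alpha> \<beta> \<gamma> = basis_coeff s e \<gamma> (star (e \<alpha>) (e \<beta>))"

text \<open>Formal series \<open>\<Sum>\<alpha>. a \<alpha> e\<^sub>\<alpha>\<close> are functions \<open>a :: 'i \<Rightarrow> complex\<close>, added pointwise.\<close>

definition fun_scale :: "complex \<Rightarrow> ('i \<Rightarrow> complex) \<Rightarrow> 'i \<Rightarrow> complex" where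
  "fun_scale c a = (\<lambda>\<alpha>. c * a \<alpha>)"

definition to_series ::
    "(complex \<Rightarrow> 'a \<Rightarrow> 'a) \<Rightarrow> ('i \<Rightarrow> 'a::ab_group_add) \<Rightarrow> 'a \<Rightarrow> 'i \<Rightarrow> complex" where
  "to_series s e x = (\<lambda>\<alpha>. basis_coeff s e \<alpha> x)"

text \<open>\<open>hh C m l \<gamma> a\<close> is meaningful for \<open>l < 2 ^ m\<close>; \<open>C \<alpha> \<beta> \<gamma>\<close> is the coefficient of \<open>e\<^sub>\<gamma>\<close> in the
  product of \<open>e\<^sub>\<alpha>\<close> and \<open>e\<^sub>\<beta>\<close>. Sums over \<^typ>\<open>ennreal\<close> always exist, and there \<open>0 * \<infinity> = 0\<close>.\<close>

primrec hh ::
    "('i \<Rightarrow> 'i \<Rightarrow> 'i \<Rightarrow> complex) \<Rightarrow> nat \<Rightarrow> nat \<Rightarrow> 'i \<Rightarrow> ('i \<Rightarrow> complex) \<Rightarrow> ennreal" where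
  "hh C 0 l \<gamma> a = ennreal (cmod (a \<gamma>))"
| "hh C (Suc m) l \<gamma> a =
     (if even l
      then (\<Sum>\<^sub>\<infinity>\<alpha>. (hh C m (l div 2) \<alpha> a)\<^sup>2 * (\<Sum>\<^sub>\<infinity>\<beta>. ennreal (cmod (C \<alpha> \<beta> \<gamma>))))
      else (\<Sum>\<^sub>\<infinity>\<beta>. (hh C m (l div 2) \<beta> a)\<^sup>2 * (\<Sum>\<^sub>\<infinity>\<alpha>. ennreal (cmod (C \<alpha> \<beta> \<gamma>)))))"

definition snorm ::
    "('i \<Rightarrow> 'i \<Rightarrow> 'i \<Rightarrow> complex) \<Rightarrow> nat \<Rightarrow> nat \<Rightarrow> 'i \<Rightarrow> ('i \<Rightarrow> complex) \<Rightarrow> ennreal" where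
  "snorm C m l \<gamma> a =
     (if hh C m l \<gamma> a = \<infinity> then \<infinity> else ennreal (root (2 ^ m) (enn2real (hh C m l \<gamma> a))))"

definition nice_series :: "('i \<Rightarrow> 'i \<Rightarrow> 'i \<Rightarrow> complex) \<Rightarrow> ('i \<Rightarrow> complex) set" where
  "nice_series C = {a. \<forall>m l \<gamma>. l < 2 ^ m \<longrightarrow> snorm C m l \<gamma> a < \<infinity>}"

definition nice_elements ::
    "(complex \<Rightarrow> 'a \<Rightarrow> 'a) \<Rightarrow> ('a \<Rightarrow> 'a \<Rightarrow> 'a) \<Rightarrow> ('i \<Rightarrow> 'a::ab_group_add) \<Rightarrow> 'a set" where
  "nice_elements s star e =
     {x. \<forall>m l \<gamma>. l < 2 ^ m \<longrightarrow> snorm (struct_const s star e) m l \<gamma> (to_series s e x) < \<infinity>}"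

definition nice_topology ::
    "(complex \<Rightarrow> 'a \<Rightarrow> 'a) \<Rightarrow> ('a \<Rightarrow> 'a \<Rightarrow> 'a) \<Rightarrow> ('i \<Rightarrow> 'a::ab_group_add) \<Rightarrow> 'a topology" where
  "nice_topology s star e =
     seminorm_topology (nice_elements s star e)
       {\<lambda>x. enn2real (snorm (struct_const s star e) m l \<gamma> (to_series s e x)) | m l \<gamma>. l < 2 ^ m}"

definition series_topology :: "('i \<Rightarrow> 'i \<Rightarrow> 'i \<Rightarrow> complex) \<Rightarrow> ('i \<Rightarrow> complex) topology" where
  "series_topology C =
     seminorm_topology (nice_series C) {\<lambda>a. enn2real (snorm C m l \<gamma> a) | m l \<gamma>. l < 2 ^ m}"

end

theory Submission
  imports Defs
begin

text \<open>Write \<open>N\<^sub>m\<close> for the seminorm that belongs to a function \<open>h\<^sub>m\<close>, where the indices \<open>\<ell>\<close> and \<open>\<gamma>\<close> are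
  suppressed.

  \<^emph>\<open>Seminorms.\<close> Each \<open>h\<^sub>m\<close> is homogeneous of degree \<open>2 ^ m\<close> and convex: the absolute value of a
  coefficient is convex, squaring preserves convexity of nonnegative functions, and so do weighted
  sums with nonnegative weights. A nonnegative convex function that is homogeneous of degree \<open>k\<close> has
  a subadditive \<open>k\<close>-th root, because its unit sublevel set is convex. So \<open>N\<^sub>m\<close> is a seminorm
  (\<open>hh_convex\<close>, \<open>rnorm_triangle\<close>).

  \<^emph>\<open>Completeness.\<close> The seminorms with \<open>m = 0\<close> are the absolute values of the coefficients. Therefore
  a Cauchy filter converges coefficientwise, and only the other seminorms of the difference to the
  coefficientwise limit remain to be estimated. By Fatou's lemma every \<open>h\<^sub>m\<close> is lower semicontinuous
  for coefficientwise convergence (\<open>hh_le_Liminf\<close>), so a Cauchy estimate for \<open>x - y\<close> survives the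
  limit in \<open>y\<close>. Since the index set is countable, there are countably many seminorms, which gives a
  metric.

  \<^emph>\<open>Product.\<close> The Cauchy--Schwarz inequality for the weights \<open>\<bar>C \<alpha> \<beta> \<gamma>\<bar>\<close> on pairs of indices bounds
  the square of a coefficient of \<open>a b\<close> by a value of \<open>h\<^sub>1\<close> at \<open>a\<close> times a value of \<open>h\<^sub>1\<close> at \<open>b\<close>. This is
  the reason for the two branches of the recursion: the even one sums the structure constants over
  the right factor, the odd one over the left factor. Applying Cauchy--Schwarz once more at every
  level gives \<open>N\<^sub>m (a b) \<le> N\<^sub>m\<^sub>+\<^sub>1 a * N\<^sub>m\<^sub>+\<^sub>1 b\<close> with suitable indices (\<open>hh_series_product\<close>), hence joint
  continuity. The same estimate shows that the double series defining the product converges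
  absolutely.

  \<^emph>\<open>Basis.\<close> Deleting finitely many coefficients of \<open>a\<close> decreases every \<open>h\<^sub>m\<close>, and along the finite
  subsets of the index set the remainder tends to zero by dominated convergence
  (\<open>hh_tail_tendsto_zero\<close>). So \<open>a\<close> is the unconditional sum of its coefficients times the unit
  series. Uniqueness of the coefficients follows from continuity of the coefficient functionals.
  The finite partial sums come from the algebra, which is therefore dense. As the topology of the
  algebra is the one pulled back along the coefficient map, the space of series is its completion.\<close>

section \<open>Topologies defined by a family of seminorms\<close>

lemma eventually_atin_topspace: "\<forall>\<^sub>F z in atin X x. z \<in> topspace X"
  by (simp add: atin_def eventually_inf_principal)

text \<open>The algebra and its completion are both topologised by seminorms, on the whole type in one case and
  on a subspace in the other. The values of a seminorm outside \<open>V\<close> are left arbitrary.\<close>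

locale seminorm_family =
  fixes s :: "complex \<Rightarrow> 'v \<Rightarrow> 'v::ab_group_add" and V :: "'v set" and P :: "('v \<Rightarrow> real) set"
  assumes vector_space: "vector_space s"
    and subspace: "module.subspace s V"
    and nonempty: "P \<noteq> {}"
    and nonneg: "\<And>p x. p \<in> P \<Longrightarrow> x \<in> V \<Longrightarrow> 0 \<le> p x"
    and triangle: "\<And>p x y. p \<in> P \<Longrightarrow> x \<in> V \<Longrightarrow> y \<in> V \<Longrightarrow> p (x + y) \<le> p x + p y"
    and homogeneous: "\<And>p c x. p \<in> P \<Longrightarrow> x \<in> V \<Longrightarrow> p (s c x) = cmod c * p x"
begin

interpretation vector_space s by (fact vector_space)

abbreviation T :: "'v topology" where "T \<equiv> seminorm_topology V P"

lemma zero_in: "0 \<in> V"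
  and add_in: "x \<in> V \<Longrightarrow> y \<in> V \<Longrightarrow> x + y \<in> V"
  and scale_in: "x \<in> V \<Longrightarrow> s c x \<in> V"
  and diff_in: "x \<in> V \<Longrightarrow> y \<in> V \<Longrightarrow> x - y \<in> V"
  using subspace_0[OF subspace] subspace_add[OF subspace] subspace_scale[OF subspace]
    subspace_diff[OF subspace] by auto

lemma seminorm_zero: "p \<in> P \<Longrightarrow> p 0 = 0"
  using homogeneous[of p 0 0] zero_in by (simp add: scale_zero_left)

lemma seminorm_minus_commute: "p \<in> P \<Longrightarrow> x \<in> V \<Longrightarrow> y \<in> V \<Longrightarrow> p (x - y) = p (y - x)"
  using homogeneous[of p "y - x" "-1"] diff_in by (simp add: scale_minus_left)

lemma seminorm_diff_triangle:
  assumes "p \<in> P" "x \<in> V" "y \<in> V" "z \<in> V"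
  shows "p (x - z) \<le> p (x - y) + p (y - z)"
  using triangle[of p "x - y" "y - z"] assms diff_in by auto

lemma topspace_T [simp]: "topspace T = V"
proof -
  obtain p where p: "p \<in> P" using nonempty by blast
  have "V \<subseteq> topspace T"
  proof
    fix x assume x: "x \<in> V"
    then have "x \<in> {y \<in> V. p (y - x) < 1}" using seminorm_zero[OF p] by simp
    moreover have "{y \<in> V. p (y - x) < 1} \<in> {{y \<in> V. p (y - x) < \<epsilon>} | p x \<epsilon>. p \<in> P \<and> x \<in> V \<and> \<epsilon> > 0}"
      using p x zero_less_one by blast
    ultimately show "x \<in> topspace T"
      unfolding seminorm_topology_def topology_generated_by_topspace by blast
  qed
  then show ?thesis
    unfolding seminorm_topology_def topology_generated_by_topspace by blast
qed

lemma openin_seminorm_ball: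
  assumes "p \<in> P" "x \<in> V"
  shows "openin T {y \<in> V. p (y - x) < \<epsilon>}"
proof (cases "\<epsilon> > 0")
  case True
  with assms show ?thesis
    unfolding seminorm_topology_def by (intro topology_generated_by_Basis) blast
next
  case False
  then have "\<not> p (y - x) < \<epsilon>" if "y \<in> V" for y
    using nonneg[OF assms(1) diff_in[OF that assms(2)]] by linarith
  then have "{y \<in> V. p (y - x) < \<epsilon>} = {}" by blast
  then show ?thesis by (simp only: openin_empty)
qed

lemma openin_multi_ball:
  assumes "finite Q" "Q \<subseteq> P" "x \<in> V"
  shows "openin T {y \<in> V. \<forall>p\<in>Q. p (y - x) < \<epsilon>}"
proof (cases "Q = {}")
  case True
  then show ?thesis using openin_topspace[of T] by simp
next
  case False
  have "{y \<in> V. \<forall>p\<in>Q. p (y - x) < \<epsilon>} = (\<Inter>p\<in>Q. {y \<in> V. p (y - x) < \<epsilon>})"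
    using False by auto
  then show ?thesis
    using False assms openin_seminorm_ball by (auto intro!: openin_INT2)
qed

text \<open>The subbasic sets are single balls with arbitrary centres, and the triangle inequality moves the
  centre to the given point. So finite intersections of balls with a common centre and a common
  radius form a neighbourhood base.\<close>

lemma openin_contains_multi_ball_ex:
  assumes "openin T U" "x \<in> U"
  shows "\<exists>Q \<epsilon>. finite Q \<and> Q \<subseteq> P \<and> \<epsilon> > 0 \<and> {y \<in> V. \<forall>p\<in>Q. p (y - x) < \<epsilon>} \<subseteq> U"
proof -
  have "generate_topology_on {{y \<in> V. p (y - x) < \<epsilon>} | p x \<epsilon>. p \<in> P \<and> x \<in> V \<and> \<epsilon> > 0} U"
    using assms(1) unfolding seminorm_topology_def by (rule openin_topology_generated_by)
  from this assms(2) show ?thesis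
  proof (induction arbitrary: x)
    case Empty
    then show ?case by simp
  next
    case (Int A B)
    obtain Q \<epsilon> where Q: "finite Q" "Q \<subseteq> P" "\<epsilon> > 0" "{y \<in> V. \<forall>p\<in>Q. p (y - x) < \<epsilon>} \<subseteq> A"
      using Int.IH(1)[of x] Int.prems by blast
    obtain R \<delta> where R: "finite R" "R \<subseteq> P" "\<delta> > 0" "{y \<in> V. \<forall>p\<in>R. p (y - x) < \<delta>} \<subseteq> B"
      using Int.IH(2)[of x] Int.prems by blast
    have "{y \<in> V. \<forall>p\<in>Q\<union>R. p (y - x) < min \<epsilon> \<delta>} \<subseteq> A \<inter> B"
      using Q(4) R(4) by (auto simp: subset_iff)
    moreover have "finite (Q \<union> R)" "Q \<union> R \<subseteq> P" "min \<epsilon> \<delta> > 0" using Q R by auto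
    ultimately show ?case by blast
  next
    case (UN K)
    then obtain k where "k \<in> K" "x \<in> k" by blast
    then show ?case using UN.IH[of k x] by (meson Sup_upper order_trans)
  next
    case (Basis S)
    then obtain p z \<epsilon> where S: "S = {y \<in> V. p (y - z) < \<epsilon>}" "p \<in> P" "z \<in> V" "\<epsilon> > 0" by blast
    then have x: "x \<in> V" "p (x - z) < \<epsilon>" using Basis.prems by auto
    have "p (y - z) < \<epsilon>" if "y \<in> V" "p (y - x) < \<epsilon> - p (x - z)" for y
      using seminorm_diff_triangle[OF S(2) that(1) x(1) S(3)] that(2) by linarith
    then have "{y \<in> V. \<forall>q\<in>{p}. q (y - x) < \<epsilon> - p (x - z)} \<subseteq> S"
      unfolding S(1) by blast
    moreover have "finite {p}" "{p} \<subseteq> P" "\<epsilon> - p (x - z) > 0" using x S by auto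
    ultimately show ?case by blast
  qed
qed

lemma openin_contains_multi_ball:
  assumes "openin T U" "x \<in> U"
  obtains Q \<epsilon> where "finite Q" "Q \<subseteq> P" "\<epsilon> > 0" "{y \<in> V. \<forall>p\<in>Q. p (y - x) < \<epsilon>} \<subseteq> U"
  using openin_contains_multi_ball_ex[OF assms] by (elim exE conjE)

text \<open>Reduces every topological question about the seminorm topology to limits of real functions.\<close>

lemma limitin_iff:
  "limitin T f l F \<longleftrightarrow>
     l \<in> V \<and> (\<forall>\<^sub>F x in F. f x \<in> V) \<and> (\<forall>p\<in>P. ((\<lambda>x. p (f x - l)) \<longlongrightarrow> 0) F)"
proof (intro iffI conjI ballI)
  assume lim: "limitin T f l F"
  then show l: "l \<in> V" using limitin_topspace[OF lim] by simp
  show ev: "\<forall>\<^sub>F x in F. f x \<in> V"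
    using limitinD[OF lim openin_topspace] l by simp
  fix p assume p: "p \<in> P"
  show "((\<lambda>x. p (f x - l)) \<longlongrightarrow> 0) F"
  proof (rule tendstoI)
    fix \<epsilon> :: real assume "\<epsilon> > 0"
    then have "\<forall>\<^sub>F x in F. f x \<in> {y \<in> V. p (y - l) < \<epsilon>}"
      using l seminorm_zero[OF p] by (intro limitinD[OF lim openin_seminorm_ball[OF p l]]) simp
    then show "\<forall>\<^sub>F x in F. dist (p (f x - l)) 0 < \<epsilon>"
    proof eventually_elim
      case (elim x)
      then show ?case using nonneg[OF p diff_in[OF _ l], of "f x"] by (simp add: dist_real_def)
    qed
  qed
next
  assume "l \<in> V \<and> (\<forall>\<^sub>F x in F. f x \<in> V) \<and> (\<forall>p\<in>P. ((\<lambda>x. p (f x - l)) \<longlongrightarrow> 0) F)"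
  then have l: "l \<in> V" and ev: "\<forall>\<^sub>F x in F. f x \<in> V"
    and lim: "\<And>p. p \<in> P \<Longrightarrow> ((\<lambda>x. p (f x - l)) \<longlongrightarrow> 0) F" by blast+
  show "limitin T f l F"
    unfolding limitin_def
  proof (intro conjI allI impI)
    show "l \<in> topspace T" using l by simp
    fix U assume "openin T U \<and> l \<in> U"
    then have "openin T U" "l \<in> U" by auto
    then obtain Q \<epsilon> where Q: "finite Q" "Q \<subseteq> P" "\<epsilon> > 0" "{y \<in> V. \<forall>p\<in>Q. p (y - l) < \<epsilon>} \<subseteq> U"
      by (rule openin_contains_multi_ball)
    have "\<forall>\<^sub>F x in F. \<forall>p\<in>Q. p (f x - l) < \<epsilon>"
    proof (intro eventually_ball_finite ballI)
      show "\<forall>\<^sub>F x in F. p (f x - l) < \<epsilon>" if "p \<in> Q" for p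
        using order_tendstoD(2)[OF lim] that Q by blast
    qed (fact Q(1))
    with ev show "\<forall>\<^sub>F x in F. f x \<in> U"
      by eventually_elim (use Q(4) in blast)
  qed
qed

lemma continuous_map_into_iff:
  "continuous_map X T f \<longleftrightarrow>
     f \<in> topspace X \<rightarrow> V \<and> (\<forall>x\<in>topspace X. \<forall>p\<in>P. ((\<lambda>z. p (f z - f x)) \<longlongrightarrow> 0) (atin X x))"
proof -
  have "\<forall>\<^sub>F z in atin X x. f z \<in> V" if "f \<in> topspace X \<rightarrow> V" for x
    using eventually_atin_topspace by eventually_elim (use that in blast)
  moreover have "f \<in> topspace X \<rightarrow> V \<longleftrightarrow> (\<forall>x\<in>topspace X. f x \<in> V)" by blast
  ultimately show ?thesis
    unfolding continuous_map_atin limitin_iff by blast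
qed

lemma continuous_map_into_seminorm:
  assumes "continuous_map X T f" "x \<in> topspace X" "p \<in> P"
  shows "((\<lambda>z. p (f z - f x)) \<longlongrightarrow> 0) (atin X x)"
  using assms unfolding continuous_map_into_iff by blast

lemma continuous_map_add:
  assumes f: "continuous_map X T f" and g: "continuous_map X T g"
  shows "continuous_map X T (\<lambda>z. f z + g z)"
proof -
  have V: "f z \<in> V" "g z \<in> V" if "z \<in> topspace X" for z
    using f g that unfolding continuous_map_into_iff by auto
  have "((\<lambda>z. p (f z + g z - (f x + g x))) \<longlongrightarrow> 0) (atin X x)" if x: "x \<in> topspace X" and p: "p \<in> P" for x p
  proof (rule tendsto_sandwich[OF _ _ tendsto_const])
    show "\<forall>\<^sub>F z in atin X x. 0 \<le> p (f z + g z - (f x + g x))"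
      using eventually_atin_topspace
      by eventually_elim (use V x nonneg[OF p] diff_in add_in in auto)
    show "\<forall>\<^sub>F z in atin X x. p (f z + g z - (f x + g x)) \<le> p (f z - f x) + p (g z - g x)"
      using eventually_atin_topspace
    proof eventually_elim
      case (elim z)
      show ?case using triangle[OF p, of "f z - f x" "g z - g x"] V[OF elim] V[OF x] diff_in
        by (simp add: add_diff_add)
    qed
    show "((\<lambda>z. p (f z - f x) + p (g z - g x)) \<longlongrightarrow> 0) (atin X x)"
      using tendsto_add[OF continuous_map_into_seminorm[OF f x p] continuous_map_into_seminorm[OF g x p]]
      by simp
  qed
  then show ?thesis unfolding continuous_map_into_iff using V add_in by auto
qed

lemma continuous_map_scale:
  assumes c: "continuous_map X euclidean c" and f: "continuous_map X T f"
  shows "continuous_map X T (\<lambda>z. s (c z) (f z))"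
proof -
  have V: "f z \<in> V" if "z \<in> topspace X" for z
    using f that unfolding continuous_map_into_iff by auto
  have "((\<lambda>z. p (s (c z) (f z) - s (c x) (f x))) \<longlongrightarrow> 0) (atin X x)"
    if x: "x \<in> topspace X" and p: "p \<in> P" for x p
  proof (rule tendsto_sandwich[OF _ _ tendsto_const])
    show "\<forall>\<^sub>F z in atin X x. 0 \<le> p (s (c z) (f z) - s (c x) (f x))"
      using eventually_atin_topspace
      by eventually_elim (use V x nonneg[OF p] diff_in scale_in in auto)
    show "\<forall>\<^sub>F z in atin X x. p (s (c z) (f z) - s (c x) (f x))
        \<le> cmod (c z) * p (f z - f x) + cmod (c z - c x) * p (f x)"
      using eventually_atin_topspace
    proof eventually_elim
      case (elim z)
      have "s (c z) (f z) - s (c x) (f x) = s (c z) (f z - f x) + s (c z - c x) (f x)"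
        by (simp add: scale_left_diff_distrib scale_right_diff_distrib)
      then show ?case
        using triangle[OF p, of "s (c z) (f z - f x)" "s (c z - c x) (f x)"]
          V[OF elim] V[OF x] diff_in scale_in homogeneous[OF p] by simp
    qed
    have c': "(c \<longlongrightarrow> c x) (atin X x)"
      using c x unfolding continuous_map_atin limitin_canonical_iff by blast
    have "((\<lambda>z. cmod (c z) * p (f z - f x) + cmod (c z - c x) * p (f x))
        \<longlongrightarrow> cmod (c x) * 0 + cmod (c x - c x) * p (f x)) (atin X x)"
      by (intro tendsto_intros c' continuous_map_into_seminorm[OF f x p])
    then show "((\<lambda>z. cmod (c z) * p (f z - f x) + cmod (c z - c x) * p (f x)) \<longlongrightarrow> 0) (atin X x)"
      by simp
  qed
  then show ?thesis unfolding continuous_map_into_iff using V scale_in by auto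
qed

lemma topological_vector_space: "topological_vector_space s T"
proof -
  have "continuous_map (prod_topology T T) T (\<lambda>z. fst z + snd z)"
    by (intro continuous_map_add continuous_map_fst continuous_map_snd)
  moreover have "continuous_map (prod_topology euclidean T) T (\<lambda>z. s (fst z) (snd z))"
    by (intro continuous_map_scale continuous_map_fst continuous_map_snd)
  ultimately show ?thesis
    unfolding topological_vector_space_def
    by (simp add: vector_space subspace case_prod_unfold)
qed

lemma locally_convex: "locally_convex s T"
  unfolding locally_convex_def
proof (intro allI impI)
  fix U assume "openin T U \<and> 0 \<in> U"
  then have "openin T U" "0 \<in> U" by auto
  then obtain Q \<epsilon> where Q: "finite Q" "Q \<subseteq> P" "\<epsilon> > 0" "{y \<in> V. \<forall>p\<in>Q. p (y - 0) < \<epsilon>} \<subseteq> U"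
    by (rule openin_contains_multi_ball)
  let ?W = "{y \<in> V. \<forall>p\<in>Q. p (y - 0) < \<epsilon>}"
  have "s (of_real (1 - t)) x + s (of_real t) y \<in> ?W"
    if xy: "x \<in> ?W" "y \<in> ?W" and t: "t \<in> {0..1}" for x y t
  proof -
    have V: "x \<in> V" "y \<in> V" using xy by auto
    have "p (s (of_real (1 - t)) x + s (of_real t) y) < \<epsilon>" if p: "p \<in> Q" for p
    proof -
      have "p \<in> P" using p Q by blast
      then have "p (s (of_real (1 - t)) x + s (of_real t) y) \<le> cmod (of_real (1 - t)) * p x + cmod (of_real t) * p y"
        using triangle[of p "s (of_real (1 - t)) x" "s (of_real t) y"] V scale_in homogeneous by metis
      also have "\<dots> = (1 - t) * p x + t * p y"
        using t unfolding norm_of_real by simp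
      also have "\<dots> < \<epsilon>"
      proof (rule convex_bound_lt)
        show "p x < \<epsilon>" "p y < \<epsilon>" using xy p by auto
      qed (use t in auto)
      finally show ?thesis .
    qed
    then show ?thesis using V add_in scale_in by simp
  qed
  moreover have "openin T ?W" by (rule openin_multi_ball[OF Q(1,2) zero_in])
  moreover have "p 0 = 0" if "p \<in> Q" for p using seminorm_zero that Q(2) by blast
  then have "\<forall>p\<in>Q. p (0 - 0) < \<epsilon>" using Q(3) by (metis diff_zero)
  then have "0 \<in> ?W" using zero_in by simp
  ultimately show "\<exists>W. openin T W \<and> 0 \<in> W \<and> W \<subseteq> U \<and>
         (\<forall>x\<in>W. \<forall>y\<in>W. \<forall>t\<in>{0..1}. s (of_real (1 - t)) x + s (of_real t) y \<in> W)"
    using Q(4) by (intro exI[of _ ?W] conjI ballI)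
qed

text \<open>Enumerate the seminorms as \<open>q\<^sub>0, q\<^sub>1, \<dots>\<close> and measure the sequence \<open>q\<^sub>n (x - y)\<close> with the metric of
  the countable product of real lines. The triangle inequality holds because this metric compares a
  sequence with zero by a weighted sum of the truncations \<open>min (q\<^sub>n (x - y)) 1\<close>. The two topologies
  agree because the product metric induces coordinatewise convergence.\<close>

lemma metrizable:
  assumes cnt: "countable P"
    and sep: "\<And>x. x \<in> V \<Longrightarrow> (\<And>p. p \<in> P \<Longrightarrow> p x = 0) \<Longrightarrow> x = 0"
  shows "metrizable_space T"
proof -
  define q where "q = from_nat_into P"
  have q: "range q = P" unfolding q_def using cnt nonempty by (simp add: range_from_nat_into)
  then have qP: "q n \<in> P" for n by blast
  define v :: "'v \<Rightarrow> nat \<Rightarrow> real" where "v x = (\<lambda>n. q n x)" for x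
  \<comment> \<open>The value outside \<open>V\<close> is chosen so that the axioms for all points of the type hold.\<close>
  define d :: "'v \<Rightarrow> 'v \<Rightarrow> real" where "d x y = (if x \<in> V \<and> y \<in> V then dist (v (x - y)) 0 else 0)" for x y
  have summ: "summable (\<lambda>n. (1/2)^n * min (f n) 1)" if "\<And>n. f n \<ge> 0" for f :: "nat \<Rightarrow> real"
    by (rule summable_comparison_test'[of "\<lambda>n. (1/2)^n" 0]) (use that in \<open>auto simp: abs_mult min_def\<close>)
  have dist_v: "dist (v x) 0 = (\<Sum>n. (1/2)^n * min \<bar>v x (from_nat n)\<bar> 1)" for x
    by (simp add: dist_fun_def)
  interpret M: Metric_space V d
  proof
    show "0 \<le> d x y" for x y by (simp add: d_def)
    show "d x y = d y x" for x y
      unfolding d_def v_def using seminorm_minus_commute[OF qP] by auto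
    show "d x y = 0 \<longleftrightarrow> x = y" if "x \<in> V" "y \<in> V" for x y
    proof
      assume "d x y = 0"
      then have "v (x - y) = 0" using that by (simp add: d_def)
      then have "q n (x - y) = 0" for n unfolding v_def by (metis zero_fun_apply)
      then have "x - y = 0" using q diff_in[OF that] by (intro sep) auto
      then show "x = y" by simp
    next
      assume "x = y"
      then show "d x y = 0" using seminorm_zero[OF qP] that by (simp add: d_def v_def zero_fun_def)
    qed
    show "d x z \<le> d x y + d y z" if V: "x \<in> V" "y \<in> V" "z \<in> V" for x y z
    proof -
      have "dist (v (x - z)) 0 \<le> (\<Sum>n. (1/2)^n * min \<bar>v (x - y) (from_nat n)\<bar> 1 + (1/2)^n * min \<bar>v (y - z) (from_nat n)\<bar> 1)"
        unfolding dist_v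
      proof (rule suminf_le)
        fix n
        have "\<bar>v (x - z) (from_nat n)\<bar> \<le> \<bar>v (x - y) (from_nat n)\<bar> + \<bar>v (y - z) (from_nat n)\<bar>"
          using seminorm_diff_triangle[OF qP V] nonneg[OF qP] diff_in V unfolding v_def by fastforce
        then have "min \<bar>v (x - z) (from_nat n)\<bar> 1 \<le> min \<bar>v (x - y) (from_nat n)\<bar> 1 + min \<bar>v (y - z) (from_nat n)\<bar> 1" by linarith
        then have "(1/2)^n * min \<bar>v (x - z) (from_nat n)\<bar> 1 \<le> (1/2)^n * (min \<bar>v (x - y) (from_nat n)\<bar> 1 + min \<bar>v (y - z) (from_nat n)\<bar> 1)"
          by (intro mult_left_mono) auto
        then show "(1/2)^n * min \<bar>v (x - z) (from_nat n)\<bar> 1 \<le> (1/2)^n * min \<bar>v (x - y) (from_nat n)\<bar> 1 + (1/2)^n * min \<bar>v (y - z) (from_nat n)\<bar> 1"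
          by (simp add: algebra_simps)
      qed (intro summable_add summ; simp)+
      also have "\<dots> = dist (v (x - y)) 0 + dist (v (y - z)) 0"
        unfolding dist_v by (intro suminf_add[symmetric] summ) auto
      finally show ?thesis using V by (simp add: d_def)
    qed
  qed
  have "openin T U \<longleftrightarrow> openin M.mtopology U" for U
  proof
    assume U: "openin T U"
    show "openin M.mtopology U"
      unfolding M.openin_mtopology
    proof (intro conjI allI impI)
      show "U \<subseteq> V" using openin_subset[OF U] by simp
      fix x assume x: "x \<in> U"
      then have xV: "x \<in> V" using \<open>U \<subseteq> V\<close> by blast
      obtain Q \<epsilon> where Q: "finite Q" "Q \<subseteq> P" "\<epsilon> > 0" "{y \<in> V. \<forall>p\<in>Q. p (y - x) < \<epsilon>} \<subseteq> U"
        by (rule openin_contains_multi_ball[OF U x])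
      obtain N where N: "finite N" "Q = q ` N" using finite_subset_image[of Q q UNIV] Q q by auto
      have "open (\<Inter>n\<in>N. {f :: nat \<Rightarrow> real. f n < \<epsilon>})"
        by (intro open_INT N(1) ballI open_Collect_less continuous_on_const)
           (auto intro: continuous_on_product_coordinates)
      moreover have "(0 :: nat \<Rightarrow> real) \<in> (\<Inter>n\<in>N. {f. f n < \<epsilon>})" using Q by simp
      ultimately obtain r where r: "r > 0" "\<And>f. dist f 0 < r \<Longrightarrow> f \<in> (\<Inter>n\<in>N. {f. f n < \<epsilon>})"
        unfolding open_dist by (metis dist_commute)
      have "M.mball x r \<subseteq> U"
      proof
        fix y assume "y \<in> M.mball x r"
        then have y: "y \<in> V" "d y x < r" by (auto simp: M.commute)
        then have "v (y - x) \<in> (\<Inter>n\<in>N. {f. f n < \<epsilon>})" using r xV by (auto simp: d_def)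
        then have "\<forall>p\<in>Q. p (y - x) < \<epsilon>" unfolding N by (auto simp: v_def)
        then show "y \<in> U" using Q y by blast
      qed
      then show "\<exists>r>0. M.mball x r \<subseteq> U" using r by blast
    qed
  next
    assume U: "openin M.mtopology U"
    show "openin T U"
    proof (subst openin_subopen, intro ballI)
      fix x assume x: "x \<in> U"
      then obtain r where r: "r > 0" "M.mball x r \<subseteq> U" using U unfolding M.openin_mtopology by blast
      have xV: "x \<in> V" using U x unfolding M.openin_mtopology by blast
      have cont: "continuous_map T euclidean (\<lambda>y. v (y - x))"
        unfolding euclidean_product_topology[symmetric] continuous_map_componentwise_UNIV
      proof (intro allI)
        fix n
        have "((\<lambda>y. q n (y - x)) \<longlongrightarrow> q n (z - x)) (atin T z)" if z: "z \<in> V" for z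
        proof (rule Lim_null[THEN iffD2], rule Lim_null_comparison)
          show "\<forall>\<^sub>F y in atin T z. norm (q n (y - x) - q n (z - x)) \<le> q n (y - z)"
            using eventually_atin_topspace
          proof eventually_elim
            case (elim y)
            then have "y \<in> V" by simp
            then show ?case
              using seminorm_diff_triangle[OF qP _ z xV, of y n]
                seminorm_diff_triangle[OF qP z _ xV, of y n] seminorm_minus_commute[OF qP z, of y n]
              by auto
          qed
          show "((\<lambda>y. q n (y - z)) \<longlongrightarrow> 0) (atin T z)"
            using continuous_map_into_seminorm[OF continuous_map_id, of z "q n"] z qP by simp
        qed
        then show "continuous_map T euclidean (\<lambda>y. v (y - x) n)"
          unfolding continuous_map_atin limitin_canonical_iff v_def by simp
      qed
      have "openin T {y \<in> topspace T. v (y - x) \<in> ball 0 r}"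
        by (rule openin_continuous_map_preimage[OF cont]) simp
      moreover have "y \<in> M.mball x r \<longleftrightarrow> y \<in> V \<and> dist 0 (v (y - x)) < r" for y
        using xV M.commute[of x y] by (auto simp: M.in_mball d_def dist_commute)
      then have "{y \<in> topspace T. v (y - x) \<in> ball 0 r} = M.mball x r"
        by (simp add: set_eq_iff del: M.in_mball)
      ultimately show "\<exists>W. openin T W \<and> x \<in> W \<and> W \<subseteq> U" using r xV by auto
    qed
  qed
  then have "T = M.mtopology" by (simp add: topology_eq)
  then show ?thesis using M.metrizable_space_mtopology by simp
qed

lemma pullback:
  fixes j :: "'w::ab_group_add \<Rightarrow> 'v"
  assumes vs: "vector_space r" and sub: "module.subspace r W"
    and lin: "linear_on r s W j" and into: "j ` W \<subseteq> V"
  shows "seminorm_family r W ((\<lambda>p x. p (j x)) ` P)"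
proof (rule seminorm_family.intro)
  show "vector_space r" "module.subspace r W" by fact+
  show "(\<lambda>p x. p (j x)) ` P \<noteq> {}" using nonempty by simp
  fix q assume "q \<in> (\<lambda>p x. p (j x)) ` P"
  then obtain p where p: "p \<in> P" "q = (\<lambda>x. p (j x))" by blast
  have j: "j x \<in> V" if "x \<in> W" for x using that into by blast
  show "0 \<le> q x" if "x \<in> W" for x using nonneg[OF p(1) j[OF that]] p(2) by simp
  show "q (x + y) \<le> q x + q y" if "x \<in> W" "y \<in> W" for x y
    using triangle[OF p(1) j[OF that(1)] j[OF that(2)]] p(2) lin that by (simp add: linear_on_def)
  show "q (r c x) = cmod c * q x" if "x \<in> W" for c x
    using homogeneous[OF p(1) j[OF that]] p(2) lin that by (simp add: linear_on_def)
qed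

text \<open>Convergence in either space is convergence of the same real functions \<open>p (j (x - y))\<close>, so both \<open>j\<close>
  and its inverse are continuous.\<close>

lemma embedding_pullback:
  fixes j :: "'w::ab_group_add \<Rightarrow> 'v"
  assumes vs: "vector_space r" and sub: "module.subspace r W"
    and lin: "linear_on r s W j" and into: "j ` W \<subseteq> V" and inj: "inj_on j W"
  shows "embedding_map (seminorm_topology W ((\<lambda>p x. p (j x)) ` P)) T j"
proof -
  interpret W: seminorm_family r W "(\<lambda>p x. p (j x)) ` P" by (rule pullback[OF vs sub lin into])
  interpret R: vector_space r by (fact vs)
  let ?S = "subtopology T (j ` W)"
  define k where "k = inv_into W j"
  have k: "k (j x) = x" if "x \<in> W" for x using inj that by (simp add: k_def)
  have top: "topspace ?S = j ` W" using into by auto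
  have jd: "j (x - y) = j x - j y" if "x \<in> W" "y \<in> W" for x y
    using lin that W.diff_in[OF that] unfolding linear_on_def by (metis add_diff_cancel diff_add_cancel)
  have "continuous_map W.T T j"
    unfolding continuous_map_into_iff
  proof (intro conjI ballI)
    show "j \<in> topspace W.T \<rightarrow> V" using into by auto
    fix x p assume x: "x \<in> topspace W.T" and p: "p \<in> P"
    have "((\<lambda>z. p (j (z - x))) \<longlongrightarrow> 0) (atin W.T x)"
      using W.continuous_map_into_seminorm[OF continuous_map_id x, of "\<lambda>x. p (j x)"] p by simp
    moreover have "\<forall>\<^sub>F z in atin W.T x. p (j (z - x)) = p (j z - j x)"
      using eventually_atin_topspace by eventually_elim (use x jd in simp)
    ultimately show "((\<lambda>z. p (j z - j x)) \<longlongrightarrow> 0) (atin W.T x)"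
      by (rule Lim_transform_eventually)
  qed
  then have 1: "continuous_map W.T ?S j"
    by (simp add: continuous_map_in_subtopology)
  have 2: "continuous_map ?S W.T k"
    unfolding W.continuous_map_into_iff
  proof (intro conjI ballI)
    show "k \<in> topspace ?S \<rightarrow> W" unfolding top using k by auto
    fix x q assume x: "x \<in> topspace ?S" and "q \<in> (\<lambda>p x. p (j x)) ` P"
    then obtain p where p: "p \<in> P" "q = (\<lambda>x. p (j x))" by blast
    have "continuous_map ?S T id" using continuous_map_from_subtopology[OF continuous_map_id] .
    from continuous_map_into_seminorm[OF this x p(1)]
    have "((\<lambda>z. p (z - x)) \<longlongrightarrow> 0) (atin ?S x)" by simp
    moreover have "\<forall>\<^sub>F z in atin ?S x. p (z - x) = q (k z - k x)"
      using eventually_atin_topspace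
    proof eventually_elim
      case (elim z)
      then obtain a b where "z = j a" "x = j b" "a \<in> W" "b \<in> W" using x unfolding top by blast
      then show ?case using k jd p(2) by simp
    qed
    ultimately show "((\<lambda>z. q (k z - k x)) \<longlongrightarrow> 0) (atin ?S x)"
      by (rule Lim_transform_eventually)
  qed
  have "homeomorphic_maps W.T ?S j k"
    unfolding homeomorphic_maps_def top using 1 2 k by auto
  then show ?thesis
    unfolding embedding_map_def W.topspace_T homeomorphic_map_maps by blast
qed

end

section \<open>Infinite sums of extended nonnegative reals\<close>

lemma ennreal_summable_on [simp]: "f summable_on A" for f :: "'a \<Rightarrow> ennreal"
  by (rule nonneg_summable_on_complete) simp

lemma power2_convex_ennreal:
  fixes x y :: ennreal
  assumes "u \<ge> 0" "v \<ge> 0" "u + v = 1"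
  shows "(ennreal u * x + ennreal v * y)\<^sup>2 \<le> ennreal u * x\<^sup>2 + ennreal v * y\<^sup>2"
proof (cases "u = 0 \<or> v = 0")
  case True
  then have "u = 0 \<and> v = 1 \<or> u = 1 \<and> v = 0" using assms by auto
  then show ?thesis by (elim disjE conjE) simp_all
next
  case False
  then have uv: "u > 0" "v > 0" using assms by auto
  show ?thesis
  proof (cases x y rule: ennreal2_cases)
    case (real_real a b)
    have v: "v = 1 - u" using assms(3) by simp
    have "u * a\<^sup>2 + v * b\<^sup>2 - (u * a + v * b)\<^sup>2 = u * v * (a - b)\<^sup>2"
      unfolding v by (simp add: power2_eq_square algebra_simps)
    also have "\<dots> \<ge> 0" using assms by simp
    finally have "(u * a + v * b)\<^sup>2 \<le> u * a\<^sup>2 + v * b\<^sup>2" by simp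
    then show ?thesis using real_real assms
      by (simp add: ennreal_mult[symmetric] ennreal_plus[symmetric] ennreal_power del: ennreal_plus)
  qed (use uv in \<open>auto simp: ennreal_mult_top power2_eq_square\<close>)
qed

text \<open>The limit inferior is a supremum over the eventual properties, and a common refinement of two such
  properties is again eventual. Addition commutes with each supremum separately.\<close>

lemma Liminf_add_ennreal:
  fixes u v :: "'a \<Rightarrow> ennreal"
  shows "Liminf F u + Liminf F v \<le> Liminf F (\<lambda>x. u x + v x)"
proof -
  have ne: "{P. eventually P F} \<noteq> {}" using eventually_True by blast
  have "Liminf F u + Liminf F v =
      (SUP Q\<in>{P. eventually P F}. SUP P\<in>{P. eventually P F}. (INF x\<in>Collect P. u x) + (INF x\<in>Collect Q. v x))"
    unfolding Liminf_def
    by (simp only: ennreal_SUP_add_left[OF ne, symmetric] ennreal_SUP_add_right[OF ne])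
  also have "\<dots> \<le> Liminf F (\<lambda>x. u x + v x)"
  proof (intro SUP_least)
    fix P Q assume PQ: "P \<in> {P. eventually P F}" "Q \<in> {P. eventually P F}"
    then have "eventually (\<lambda>x. P x \<and> Q x) F" by (simp add: eventually_conj)
    then have "eventually (\<lambda>x. (INF x\<in>Collect P. u x) + (INF x\<in>Collect Q. v x) \<le> u x + v x) F"
      by eventually_elim (auto intro!: add_mono INF_lower)
    then show "(INF x\<in>Collect P. u x) + (INF x\<in>Collect Q. v x) \<le> Liminf F (\<lambda>x. u x + v x)"
      by (rule Liminf_bounded)
  qed
  finally show ?thesis .
qed

text \<open>Even with \<open>0 * \<infinity> = 0\<close> multiplication commutes with suprema in each argument, so the argument for
  sums applies.\<close>

lemma Liminf_mult_ennreal: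
  fixes u v :: "'a \<Rightarrow> ennreal"
  shows "Liminf F u * Liminf F v \<le> Liminf F (\<lambda>x. u x * v x)"
proof -
  have "Liminf F u * Liminf F v =
      (SUP Q\<in>{P. eventually P F}. SUP P\<in>{P. eventually P F}. (INF x\<in>Collect P. u x) * (INF x\<in>Collect Q. v x))"
    unfolding Liminf_def
    by (simp only: SUP_mult_right_ennreal SUP_mult_left_ennreal)
  also have "\<dots> \<le> Liminf F (\<lambda>x. u x * v x)"
  proof (intro SUP_least)
    fix P Q assume PQ: "P \<in> {P. eventually P F}" "Q \<in> {P. eventually P F}"
    then have "eventually (\<lambda>x. P x \<and> Q x) F" by (simp add: eventually_conj)
    then have "eventually (\<lambda>x. (INF x\<in>Collect P. u x) * (INF x\<in>Collect Q. v x) \<le> u x * v x) F"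
      by eventually_elim (auto intro!: mult_mono INF_lower)
    then show "(INF x\<in>Collect P. u x) * (INF x\<in>Collect Q. v x) \<le> Liminf F (\<lambda>x. u x * v x)"
      by (rule Liminf_bounded)
  qed
  finally show ?thesis .
qed

lemma infsum_mono_ennreal:
  fixes f g :: "'a \<Rightarrow> ennreal"
  assumes "\<And>x. x \<in> A \<Longrightarrow> f x \<le> g x"
  shows "infsum f A \<le> infsum g A"
  using assms by (intro infsum_mono) auto

lemma sum_le_infsum_ennreal:
  fixes f :: "'a \<Rightarrow> ennreal"
  assumes "finite K" "K \<subseteq> A"
  shows "sum f K \<le> infsum f A"
  unfolding nonneg_infsum_complete[of A f, simplified] using assms by (intro SUP_upper) auto

lemma infsum_cmult_ennreal:
  fixes f :: "'a \<Rightarrow> ennreal"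
  shows "(\<Sum>\<^sub>\<infinity>x\<in>A. c * f x) = c * infsum f A"
  by (simp add: nonneg_infsum_complete SUP_mult_left_ennreal sum_distrib_left)

text \<open>Fatou's lemma for sums holds along an arbitrary filter, in contrast to the one for integrals,
  because a sum is the supremum of its finite partial sums.\<close>

lemma infsum_Fatou_ennreal:
  fixes f :: "'b \<Rightarrow> 'a \<Rightarrow> ennreal"
  shows "(\<Sum>\<^sub>\<infinity>a\<in>A. Liminf F (\<lambda>x. f x a)) \<le> Liminf F (\<lambda>x. \<Sum>\<^sub>\<infinity>a\<in>A. f x a)"
proof (rule infsum_le_finite_sums)
  fix K assume K: "finite K" "K \<subseteq> A"
  have "(\<Sum>a\<in>K. Liminf F (\<lambda>x. f x a)) \<le> Liminf F (\<lambda>x. \<Sum>a\<in>K. f x a)"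
    using K(1)
  proof induction
    case empty
    then show ?case by simp
  next
    case (insert a K)
    then have "(\<Sum>a\<in>insert a K. Liminf F (\<lambda>x. f x a)) \<le> Liminf F (\<lambda>x. f x a) + Liminf F (\<lambda>x. \<Sum>a\<in>K. f x a)"
      by (simp add: add_left_mono)
    also have "\<dots> \<le> Liminf F (\<lambda>x. f x a + (\<Sum>a\<in>K. f x a))" by (rule Liminf_add_ennreal)
    finally show ?case using insert by simp
  qed
  also have "\<dots> \<le> Liminf F (\<lambda>x. \<Sum>\<^sub>\<infinity>a\<in>A. f x a)"
    using K by (intro Liminf_mono always_eventually allI sum_le_infsum_ennreal)
  finally show "(\<Sum>a\<in>K. Liminf F (\<lambda>x. f x a)) \<le> Liminf F (\<lambda>x. \<Sum>\<^sub>\<infinity>a\<in>A. f x a)" .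
qed simp

text \<open>For a finite index set this is the inequality for integrals over a weighted point measure. Squaring
  is continuous on the extended nonnegative reals, so the inequality passes to the limit.\<close>

lemma infsum_Cauchy_Schwarz_ennreal:
  fixes f g w :: "'a \<Rightarrow> ennreal"
  shows "(\<Sum>\<^sub>\<infinity>x\<in>A. w x * (f x * g x))\<^sup>2 \<le> (\<Sum>\<^sub>\<infinity>x\<in>A. w x * (f x)\<^sup>2) * (\<Sum>\<^sub>\<infinity>x\<in>A. w x * (g x)\<^sup>2)"
proof -
  let ?s = "\<Sum>\<^sub>\<infinity>x\<in>A. w x * (f x * g x)"
  have "((\<lambda>K. \<Sum>x\<in>K. w x * (f x * g x)) \<longlongrightarrow> ?s) (finite_subsets_at_top A)"
    using has_sum_infsum[OF ennreal_summable_on] unfolding has_sum_def .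
  then have "((\<lambda>K. (\<Sum>x\<in>K. w x * (f x * g x)) * (\<Sum>x\<in>K. w x * (f x * g x))) \<longlongrightarrow> ?s * ?s) (finite_subsets_at_top A)"
    by (intro tendsto_mult_ennreal) auto
  then show ?thesis
    unfolding power2_eq_square[of ?s]
  proof (rule tendsto_upperbound)
    show "\<forall>\<^sub>F K in finite_subsets_at_top A. (\<Sum>x\<in>K. w x * (f x * g x)) * (\<Sum>x\<in>K. w x * (f x * g x))
        \<le> (\<Sum>\<^sub>\<infinity>x\<in>A. w x * (f x)\<^sup>2) * (\<Sum>\<^sub>\<infinity>x\<in>A. w x * (g x)\<^sup>2)"
    proof (rule eventually_finite_subsets_at_top_weakI)
      fix K assume K: "finite K" "K \<subseteq> A"
      have "(\<Sum>x\<in>K. w x * (f x * g x))\<^sup>2 \<le> (\<Sum>x\<in>K. w x * (f x)\<^sup>2) * (\<Sum>x\<in>K. w x * (g x)\<^sup>2)"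
        using Cauchy_Schwarz_nn_integral[of f "point_measure K w" g] K(1)
        by (simp add: nn_integral_point_measure_finite)
      also have "\<dots> \<le> (\<Sum>\<^sub>\<infinity>x\<in>A. w x * (f x)\<^sup>2) * (\<Sum>\<^sub>\<infinity>x\<in>A. w x * (g x)\<^sup>2)"
        using K by (intro mult_mono sum_le_infsum_ennreal) auto
      finally show "(\<Sum>x\<in>K. w x * (f x * g x)) * (\<Sum>x\<in>K. w x * (f x * g x))
        \<le> (\<Sum>\<^sub>\<infinity>x\<in>A. w x * (f x)\<^sup>2) * (\<Sum>\<^sub>\<infinity>x\<in>A. w x * (g x)\<^sup>2)"
        unfolding power2_eq_square[of "\<Sum>x\<in>K. w x * (f x * g x)"] .
    qed
  qed simp
qed

lemma infsum_tail_ennreal: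
  fixes g :: "'a \<Rightarrow> ennreal"
  assumes "infsum g UNIV < top" "\<epsilon> > 0"
  obtains K where "finite K" "infsum g (- K) < \<epsilon>"
proof (cases "infsum g UNIV = 0")
  case True
  have "infsum g (- {}) < \<epsilon>" using True assms by simp
  then show ?thesis using that by blast
next
  case False
  then have lt: "infsum g UNIV - \<epsilon> < infsum g UNIV"
    using assms by (intro ennreal_between) (auto simp: zero_less_iff_neq_zero)
  then obtain K where K: "finite K" "infsum g UNIV - \<epsilon> < sum g K"
    unfolding nonneg_infsum_complete[of UNIV g, simplified] less_SUP_iff by auto
  have split: "infsum g UNIV = sum g K + infsum g (- K)"
    using infsum_Un_disjoint[of g K "- K"] K by simp
  have fin: "sum g K < top" using split assms(1) by (metis ennreal_add_eq_top top.not_eq_extremum)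
  have "sum g K + infsum g (- K) < sum g K + \<epsilon>"
  proof (cases "\<epsilon> \<le> infsum g UNIV \<and> \<epsilon> < top")
    case True
    then show ?thesis using K(2) split minus_less_iff_ennreal[of \<epsilon> "infsum g UNIV" "sum g K"] by simp
  next
    case False
    have "infsum g UNIV < \<epsilon>"
    proof (cases "\<epsilon> < top")
      case True
      then show ?thesis using False by auto
    next
      case False
      then have "\<epsilon> = top" by (simp add: less_top[symmetric])
      then show ?thesis using assms(1) by simp
    qed
    also have "\<epsilon> \<le> sum g K + \<epsilon>" by simp
    finally show ?thesis using split by simp
  qed
  then have "infsum g (- K) < \<epsilon>" using fin by (simp add: ennreal_add_left_cancel_less)
  then show ?thesis using that K(1) by blast
qed

text \<open>Dominated convergence along an arbitrary filter: outside a finite set the majorant has a small sum,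
  and on that set finitely many limits suffice.\<close>

lemma infsum_dominated_to_zero_ennreal:
  fixes f :: "'b \<Rightarrow> 'a \<Rightarrow> ennreal"
  assumes le: "\<And>x a. f x a \<le> g a" and fin: "infsum g UNIV < top"
    and lim: "\<And>a. ((\<lambda>x. f x a) \<longlongrightarrow> 0) F"
  shows "((\<lambda>x. infsum (f x) UNIV) \<longlongrightarrow> 0) F"
proof (rule tendsto_zero_ennreal)
  fix r :: real assume r: "r > 0"
  obtain K where K: "finite K" "infsum g (- K) < ennreal (r / 2)"
    using infsum_tail_ennreal[OF fin, of "ennreal (r / 2)"] r by auto
  have "((\<lambda>x. \<Sum>a\<in>K. f x a) \<longlongrightarrow> (\<Sum>a\<in>K. 0)) F" by (intro tendsto_sum lim)
  then have "\<forall>\<^sub>F x in F. (\<Sum>a\<in>K. f x a) < ennreal (r / 2)"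
    using r by (intro order_tendstoD(2)[where y = 0]) auto
  then show "\<forall>\<^sub>F x in F. infsum (f x) UNIV < ennreal r"
  proof eventually_elim
    case (elim x)
    have "infsum (f x) UNIV = sum (f x) K + infsum (f x) (- K)"
      using infsum_Un_disjoint[of "f x" K "- K"] K by simp
    also have "\<dots> \<le> sum (f x) K + infsum g (- K)" by (intro add_left_mono infsum_mono_ennreal le)
    also have "\<dots> < ennreal (r / 2) + ennreal (r / 2)" using elim K by (intro add_strict_mono) auto
    also have "\<dots> = ennreal r" using r by (simp add: ennreal_plus[symmetric] del: ennreal_plus)
    finally show ?case .
  qed
qed

lemma abs_summable_on_if_infsum_ennreal_finite:
  fixes f :: "'a \<Rightarrow> 'b::banach"
  assumes "(\<Sum>\<^sub>\<infinity>x\<in>A. ennreal (norm (f x))) < top"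
  shows "f abs_summable_on A"
proof (rule nonneg_bdd_above_summable_on)
  show "bdd_above (sum (\<lambda>x. norm (f x)) ` {F. F \<subseteq> A \<and> finite F})"
  proof (rule bdd_aboveI2)
    fix K assume K: "K \<in> {F. F \<subseteq> A \<and> finite F}"
    have "ennreal (\<Sum>x\<in>K. norm (f x)) \<le> (\<Sum>\<^sub>\<infinity>x\<in>A. ennreal (norm (f x)))"
      using K sum_le_infsum_ennreal[of K A "\<lambda>x. ennreal (norm (f x))"] by simp
    then show "(\<Sum>x\<in>K. norm (f x)) \<le> enn2real (\<Sum>\<^sub>\<infinity>x\<in>A. ennreal (norm (f x)))"
      using assms by (metis ennreal_enn2real enn2real_nonneg ennreal_le_iff)
  qed
qed simp

lemma norm_infsum_le_ennreal:
  fixes f :: "'a \<Rightarrow> 'b::banach"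
  shows "ennreal (norm (infsum f A)) \<le> (\<Sum>\<^sub>\<infinity>x\<in>A. ennreal (norm (f x)))"
proof (cases "(\<Sum>\<^sub>\<infinity>x\<in>A. ennreal (norm (f x))) < top")
  case True
  then have abs: "f abs_summable_on A" by (rule abs_summable_on_if_infsum_ennreal_finite)
  have "ennreal (norm (infsum f A)) \<le> ennreal (\<Sum>\<^sub>\<infinity>x\<in>A. norm (f x))"
    by (intro ennreal_leI norm_infsum_bound abs)
  also have "\<dots> = (SUP F\<in>{F. finite F \<and> F \<subseteq> A}. (ennreal (\<Sum>x\<in>F. norm (f x))))"
    by (rule infsum_nonneg_is_SUPREMUM_ennreal[OF abs]) simp
  also have "\<dots> \<le> (\<Sum>\<^sub>\<infinity>x\<in>A. ennreal (norm (f x)))"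
  proof (rule SUP_least)
    fix F assume "F \<in> {F. finite F \<and> F \<subseteq> A}"
    then show "ennreal (\<Sum>x\<in>F. norm (f x)) \<le> (\<Sum>\<^sub>\<infinity>x\<in>A. ennreal (norm (f x)))"
      using sum_le_infsum_ennreal[of F A "\<lambda>x. ennreal (norm (f x))"] by simp
  qed
  finally show ?thesis .
qed (simp add: less_top[symmetric])

lemma infsum_product_le_ennreal:
  fixes f :: "'a \<Rightarrow> 'b \<Rightarrow> ennreal"
  shows "(\<Sum>\<^sub>\<infinity>(x, y). f x y) \<le> (\<Sum>\<^sub>\<infinity>x. \<Sum>\<^sub>\<infinity>y. f x y)"
    and "(\<Sum>\<^sub>\<infinity>(x, y). f x y) \<le> (\<Sum>\<^sub>\<infinity>y. \<Sum>\<^sub>\<infinity>x. f x y)"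
proof -
  have K: "K \<subseteq> fst ` K \<times> snd ` K" for K :: "('a \<times> 'b) set" by force
  have "(\<Sum>(x, y)\<in>K. f x y) \<le> (\<Sum>\<^sub>\<infinity>x. \<Sum>\<^sub>\<infinity>y. f x y)"
    and "(\<Sum>(x, y)\<in>K. f x y) \<le> (\<Sum>\<^sub>\<infinity>y. \<Sum>\<^sub>\<infinity>x. f x y)" if "finite K" for K
  proof -
    have le: "(\<Sum>(x, y)\<in>K. f x y) \<le> (\<Sum>(x, y)\<in>fst ` K \<times> snd ` K. f x y)"
      using that K by (intro sum_mono2) auto
    have "(\<Sum>(x, y)\<in>fst ` K \<times> snd ` K. f x y) = (\<Sum>x\<in>fst ` K. \<Sum>y\<in>snd ` K. f x y)"
      by (rule sum.cartesian_product[symmetric])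
    also have "\<dots> \<le> (\<Sum>x\<in>fst ` K. \<Sum>\<^sub>\<infinity>y. f x y)"
      using that by (intro sum_mono sum_le_infsum_ennreal) auto
    also have "\<dots> \<le> (\<Sum>\<^sub>\<infinity>x. \<Sum>\<^sub>\<infinity>y. f x y)"
      using that by (intro sum_le_infsum_ennreal) auto
    finally show "(\<Sum>(x, y)\<in>K. f x y) \<le> (\<Sum>\<^sub>\<infinity>x. \<Sum>\<^sub>\<infinity>y. f x y)" using le by order
    have "(\<Sum>(x, y)\<in>fst ` K \<times> snd ` K. f x y) = (\<Sum>x\<in>fst ` K. \<Sum>y\<in>snd ` K. f x y)"
      by (rule sum.cartesian_product[symmetric])
    also have "\<dots> = (\<Sum>y\<in>snd ` K. \<Sum>x\<in>fst ` K. f x y)" by (rule sum.swap)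
    also have "\<dots> \<le> (\<Sum>y\<in>snd ` K. \<Sum>\<^sub>\<infinity>x. f x y)"
      using that by (intro sum_mono sum_le_infsum_ennreal) auto
    also have "\<dots> \<le> (\<Sum>\<^sub>\<infinity>y. \<Sum>\<^sub>\<infinity>x. f x y)"
      using that by (intro sum_le_infsum_ennreal) auto
    finally show "(\<Sum>(x, y)\<in>K. f x y) \<le> (\<Sum>\<^sub>\<infinity>y. \<Sum>\<^sub>\<infinity>x. f x y)" using le by order
  qed
  then show "(\<Sum>\<^sub>\<infinity>(x, y). f x y) \<le> (\<Sum>\<^sub>\<infinity>x. \<Sum>\<^sub>\<infinity>y. f x y)"
    and "(\<Sum>\<^sub>\<infinity>(x, y). f x y) \<le> (\<Sum>\<^sub>\<infinity>y. \<Sum>\<^sub>\<infinity>x. f x y)"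
    by (auto intro!: infsum_le_finite_sums)
qed

section \<open>Analytic properties of the functions \<open>h\<close>\<close>

text \<open>With this notation both branches of the recursion for \<open>h\<close> are sums of squares against one family of weights that
  depends on \<open>l\<close> through its parity only.\<close>

definition weight :: "('i \<Rightarrow> 'i \<Rightarrow> 'i \<Rightarrow> complex) \<Rightarrow> nat \<Rightarrow> 'i \<Rightarrow> 'i \<Rightarrow> ennreal" where
  "weight C l \<gamma> \<alpha> = (if even l then \<Sum>\<^sub>\<infinity>\<beta>. ennreal (cmod (C \<alpha> \<beta> \<gamma>)) else \<Sum>\<^sub>\<infinity>\<beta>. ennreal (cmod (C \<beta> \<alpha> \<gamma>)))"

lemma hh_Suc_weight:
  "hh C (Suc m) l \<gamma> a = (\<Sum>\<^sub>\<infinity>\<alpha>. weight C l \<gamma> \<alpha> * (hh C m (l div 2) \<alpha> a)\<^sup>2)"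
  by (simp add: weight_def mult.commute)

declare hh.simps(2) [simp del]

lemma hh_mono:
  assumes "\<And>\<alpha>. cmod (a \<alpha>) \<le> cmod (b \<alpha>)"
  shows "hh C m l \<gamma> a \<le> hh C m l \<gamma> b"
proof (induction m arbitrary: l \<gamma>)
  case 0
  then show ?case using assms by (simp add: ennreal_leI)
next
  case (Suc m)
  show ?case unfolding hh_Suc_weight
    by (intro infsum_mono_ennreal mult_left_mono power_mono Suc.IH) auto
qed

lemma hh_fun_scale: "hh C m l \<gamma> (fun_scale c a) = ennreal (cmod c ^ (2 ^ m)) * hh C m l \<gamma> a"
proof (induction m arbitrary: l \<gamma>)
  case 0
  then show ?case by (simp add: fun_scale_def norm_mult ennreal_mult)
next
  case (Suc m)
  have *: "(ennreal (cmod c ^ 2 ^ m))\<^sup>2 = ennreal (cmod c ^ 2 ^ Suc m)"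
    by (simp add: ennreal_power power_mult[symmetric] mult.commute)
  have "weight C l \<gamma> \<alpha> * (ennreal (cmod c ^ 2 ^ m) * h)\<^sup>2 = ennreal (cmod c ^ 2 ^ Suc m) * (weight C l \<gamma> \<alpha> * h\<^sup>2)" for \<alpha> h
    unfolding power_mult_distrib * by (rule mult.left_commute)
  then show ?case unfolding hh_Suc_weight Suc.IH by (simp only: infsum_cmult_ennreal)
qed

lemma hh_convex:
  assumes "u \<ge> 0" "v \<ge> 0" "u + v = 1"
  shows "hh C m l \<gamma> (fun_scale (of_real u) a + fun_scale (of_real v) b)
    \<le> ennreal u * hh C m l \<gamma> a + ennreal v * hh C m l \<gamma> b"
proof (induction m arbitrary: l \<gamma>)
  case 0
  have "cmod (of_real u * a \<gamma> + of_real v * b \<gamma>) \<le> u * cmod (a \<gamma>) + v * cmod (b \<gamma>)"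
    using assms by (intro norm_triangle_le) (simp add: norm_mult)
  then show ?case using assms
    by (simp add: fun_scale_def ennreal_mult[symmetric] ennreal_plus[symmetric] ennreal_leI del: ennreal_plus)
next
  case (Suc m)
  let ?c = "fun_scale (of_real u) a + fun_scale (of_real v) b"
  let ?w = "weight C l \<gamma>" and ?h = "\<lambda>a \<alpha>. hh C m (l div 2) \<alpha> a"
  have "hh C (Suc m) l \<gamma> ?c \<le> (\<Sum>\<^sub>\<infinity>\<alpha>. ennreal u * (?w \<alpha> * (?h a \<alpha>)\<^sup>2) + ennreal v * (?w \<alpha> * (?h b \<alpha>)\<^sup>2))"
    unfolding hh_Suc_weight
  proof (rule infsum_mono_ennreal)
    fix \<alpha>
    have "(?h ?c \<alpha>)\<^sup>2 \<le> (ennreal u * ?h a \<alpha> + ennreal v * ?h b \<alpha>)\<^sup>2"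
      by (intro power_mono Suc.IH) simp
    also have "\<dots> \<le> ennreal u * (?h a \<alpha>)\<^sup>2 + ennreal v * (?h b \<alpha>)\<^sup>2"
      by (rule power2_convex_ennreal[OF assms])
    finally have "?w \<alpha> * (?h ?c \<alpha>)\<^sup>2 \<le> ?w \<alpha> * (ennreal u * (?h a \<alpha>)\<^sup>2 + ennreal v * (?h b \<alpha>)\<^sup>2)"
      by (rule mult_left_mono) simp
    then show "?w \<alpha> * (?h ?c \<alpha>)\<^sup>2 \<le> ennreal u * (?w \<alpha> * (?h a \<alpha>)\<^sup>2) + ennreal v * (?w \<alpha> * (?h b \<alpha>)\<^sup>2)"
      by (simp add: distrib_left mult.left_commute)
  qed
  also have "\<dots> = ennreal u * hh C (Suc m) l \<gamma> a + ennreal v * hh C (Suc m) l \<gamma> b"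
    unfolding hh_Suc_weight by (simp add: infsum_add infsum_cmult_ennreal)
  finally show ?case .
qed

text \<open>Lower semicontinuity for coefficientwise convergence, by Fatou's lemma at each level of the
  recursion.\<close>

lemma hh_le_Liminf:
  assumes "F \<noteq> bot" and lim: "\<And>\<alpha>. ((\<lambda>x. f x \<alpha>) \<longlongrightarrow> a \<alpha>) F"
  shows "hh C m l \<gamma> a \<le> Liminf F (\<lambda>x. hh C m l \<gamma> (f x))"
proof (induction m arbitrary: l \<gamma>)
  case 0
  have "((\<lambda>x. ennreal (cmod (f x \<gamma>))) \<longlongrightarrow> ennreal (cmod (a \<gamma>))) F"
    by (intro tendsto_intros lim)
  from lim_imp_Liminf[OF assms(1) this] show ?case unfolding hh.simps(1) by simp
next
  case (Suc m)
  let ?w = "weight C l \<gamma>" and ?h = "\<lambda>a \<alpha>. hh C m (l div 2) \<alpha> a"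
  have "hh C (Suc m) l \<gamma> a \<le> (\<Sum>\<^sub>\<infinity>\<alpha>. Liminf F (\<lambda>x. ?w \<alpha> * (?h (f x) \<alpha>)\<^sup>2))"
    unfolding hh_Suc_weight
  proof (rule infsum_mono_ennreal)
    fix \<alpha>
    have "?w \<alpha> * (?h a \<alpha>)\<^sup>2 \<le> Liminf F (\<lambda>x. ?w \<alpha>) * (Liminf F (\<lambda>x. ?h (f x) \<alpha>))\<^sup>2"
      unfolding Liminf_const[OF assms(1)] by (intro mult_left_mono power_mono Suc.IH) simp_all
    also have "\<dots> \<le> Liminf F (\<lambda>x. ?w \<alpha>) * Liminf F (\<lambda>x. (?h (f x) \<alpha>)\<^sup>2)"
      unfolding power2_eq_square by (intro mult_left_mono Liminf_mult_ennreal) simp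
    also have "\<dots> \<le> Liminf F (\<lambda>x. ?w \<alpha> * (?h (f x) \<alpha>)\<^sup>2)" by (rule Liminf_mult_ennreal)
    finally show "?w \<alpha> * (?h a \<alpha>)\<^sup>2 \<le> Liminf F (\<lambda>x. ?w \<alpha> * (?h (f x) \<alpha>)\<^sup>2)" .
  qed
  also have "\<dots> \<le> Liminf F (\<lambda>x. hh C (Suc m) l \<gamma> (f x))"
    unfolding hh_Suc_weight by (rule infsum_Fatou_ennreal)
  finally show ?case .
qed

section \<open>The seminorms on formal series\<close>

text \<open>The seminorms with real values; an infinite value is replaced by \<open>0\<close>, so statements about them
  carry a finiteness hypothesis on \<open>h\<close> where that matters.\<close>

definition rnorm :: "('i \<Rightarrow> 'i \<Rightarrow> 'i \<Rightarrow> complex) \<Rightarrow> nat \<Rightarrow> nat \<Rightarrow> 'i \<Rightarrow> ('i \<Rightarrow> complex) \<Rightarrow> real" where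
  "rnorm C m l \<gamma> = (\<lambda>a. enn2real (snorm C m l \<gamma> a))"

lemma rnorm_eq_root: "rnorm C m l \<gamma> a = root (2 ^ m) (enn2real (hh C m l \<gamma> a))"
  by (simp add: rnorm_def snorm_def)

lemma rnorm_nonneg [simp]: "0 \<le> rnorm C m l \<gamma> a"
  by (simp add: rnorm_def)

lemma snorm_finite_iff: "snorm C m l \<gamma> a < \<infinity> \<longleftrightarrow> hh C m l \<gamma> a < top"
  by (simp add: snorm_def less_top[symmetric])

lemma nice_series_iff: "a \<in> nice_series C \<longleftrightarrow> (\<forall>m l \<gamma>. l < 2 ^ m \<longrightarrow> hh C m l \<gamma> a < top)"
  unfolding nice_series_def mem_Collect_eq snorm_finite_iff ..

lemma hh_finite: "a \<in> nice_series C \<Longrightarrow> l < 2 ^ m \<Longrightarrow> hh C m l \<gamma> a < top"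
  unfolding nice_series_iff by blast

lemma hh_eq_rnorm_power:
  assumes "hh C m l \<gamma> a < top"
  shows "hh C m l \<gamma> a = ennreal (rnorm C m l \<gamma> a ^ 2 ^ m)"
proof -
  have "rnorm C m l \<gamma> a ^ 2 ^ m = enn2real (hh C m l \<gamma> a)"
    unfolding rnorm_eq_root by (rule real_root_pow_pos2) auto
  then show ?thesis using assms by simp
qed

text \<open>The hypothesis forces \<open>h\<close> to be finite, so the left side is a root of \<open>h\<close> and not the default
  value.\<close>

lemma rnorm_le_if_hh_le:
  assumes "hh C m l \<gamma> a \<le> ennreal (s ^ 2 ^ m)" "s \<ge> 0"
  shows "rnorm C m l \<gamma> a \<le> s"
proof (rule power_mono_iff[THEN iffD1])
  have "hh C m l \<gamma> a < top" using assms by (simp add: order_le_less_trans)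
  then show "rnorm C m l \<gamma> a ^ 2 ^ m \<le> s ^ 2 ^ m"
    using assms hh_eq_rnorm_power[of C m l \<gamma> a] by simp
qed (use assms in auto)

lemma rnorm_coordinate: "rnorm C 0 l \<gamma> a = cmod (a \<gamma>)"
  by (simp add: rnorm_eq_root)

lemma rnorm_fun_scale: "rnorm C m l \<gamma> (fun_scale c a) = cmod c * rnorm C m l \<gamma> a"
proof -
  have "root (2 ^ m) (cmod c ^ 2 ^ m) = cmod c" by (rule real_root_power_cancel) auto
  then show ?thesis
    by (simp add: rnorm_eq_root hh_fun_scale enn2real_mult real_root_mult)
qed

text \<open>After scaling, \<open>a\<close> and \<open>b\<close> lie in the unit sublevel set of \<open>h\<close>, which is convex. The scaling factors
  \<open>s\<close> and \<open>t\<close> are taken strictly larger than the seminorms, so that they are positive, and then tend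
  to them.\<close>

lemma
  assumes a: "hh C m l \<gamma> a < top" and b: "hh C m l \<gamma> b < top"
  shows rnorm_triangle: "rnorm C m l \<gamma> (a + b) \<le> rnorm C m l \<gamma> a + rnorm C m l \<gamma> b"
    and hh_add_finite: "hh C m l \<gamma> (a + b) < top"
proof -
  have le: "hh C m l \<gamma> (a + b) \<le> ennreal ((s + t) ^ 2 ^ m)"
    if s: "rnorm C m l \<gamma> a < s" and t: "rnorm C m l \<gamma> b < t" for s t
  proof -
    have pos: "s > 0" "t > 0" using s t rnorm_nonneg[of C m l \<gamma>] by (meson order_le_less_trans)+
    \<comment> \<open>Homogeneity moves \<open>x\<close> into the unit sublevel set of \<open>h\<close>.\<close>
    have unit: "hh C m l \<gamma> (fun_scale (of_real (1 / r)) x) \<le> 1"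
      if "hh C m l \<gamma> x < top" "rnorm C m l \<gamma> x < r" "r > 0" for r x
    proof -
      have "hh C m l \<gamma> (fun_scale (of_real (1 / r)) x) = ennreal ((1 / r) ^ 2 ^ m) * ennreal (rnorm C m l \<gamma> x ^ 2 ^ m)"
        unfolding hh_fun_scale hh_eq_rnorm_power[OF that(1)] norm_of_real using that(3) by simp
      also have "\<dots> = ennreal ((rnorm C m l \<gamma> x / r) ^ 2 ^ m)"
        using that by (simp add: ennreal_mult[symmetric] power_divide)
      also have "\<dots> \<le> 1" using that by (simp add: power_le_one)
      finally show ?thesis .
    qed
    \<comment> \<open>With these weights \<open>(a + b) / (s + t)\<close> is the convex combination of \<open>a / s\<close> and \<open>b / t\<close>.\<close>
    define u v where "u = s / (s + t)" and "v = t / (s + t)"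
    have uv: "u \<ge> 0" "v \<ge> 0" "u + v = 1" using pos unfolding u_def v_def
      by (auto simp: add_divide_distrib[symmetric])
    let ?c = "fun_scale (of_real u) (fun_scale (of_real (1 / s)) a) + fun_scale (of_real v) (fun_scale (of_real (1 / t)) b)"
    have "s + t \<noteq> 0" using pos by simp
    then have "(s + t) * (u * (1 / s)) = 1" "(s + t) * (v * (1 / t)) = 1"
      unfolding u_def v_def using pos by simp_all
    then have "of_real (s + t) * (of_real u * of_real (1 / s)) = (1 :: complex)"
      "of_real (s + t) * (of_real v * of_real (1 / t)) = (1 :: complex)"
      unfolding of_real_mult[symmetric] by simp_all
    then have ab: "a + b = fun_scale (of_real (s + t)) ?c"
      unfolding fun_eq_iff fun_scale_def plus_fun_def distrib_left mult.assoc[symmetric] by simp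
    have "hh C m l \<gamma> ?c \<le> ennreal u * 1 + ennreal v * 1"
      by (rule order_trans[OF hh_convex[OF uv]]) (intro add_mono mult_left_mono unit a b s t pos; simp)
    also have "ennreal u * 1 + ennreal v * 1 = 1"
      using uv by (simp add: ennreal_plus[symmetric] del: ennreal_plus)
    finally have "ennreal ((s + t) ^ 2 ^ m) * hh C m l \<gamma> ?c \<le> ennreal ((s + t) ^ 2 ^ m) * 1"
      by (rule mult_left_mono) simp
    moreover have "cmod (of_real (s + t)) = s + t" using pos by (simp only: norm_of_real)
    then have "hh C m l \<gamma> (a + b) = ennreal ((s + t) ^ 2 ^ m) * hh C m l \<gamma> ?c"
      by (subst ab) (simp only: hh_fun_scale[where c = "of_real (s + t)"])
    ultimately show ?thesis by simp
  qed
  then show "hh C m l \<gamma> (a + b) < top"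
    using le[of "rnorm C m l \<gamma> a + 1" "rnorm C m l \<gamma> b + 1"] by (simp add: order_le_less_trans)
  show "rnorm C m l \<gamma> (a + b) \<le> rnorm C m l \<gamma> a + rnorm C m l \<gamma> b"
  proof (rule field_le_epsilon)
    fix \<epsilon> :: real assume "\<epsilon> > 0"
    then have "rnorm C m l \<gamma> (a + b) \<le> (rnorm C m l \<gamma> a + \<epsilon> / 2) + (rnorm C m l \<gamma> b + \<epsilon> / 2)"
      by (intro rnorm_le_if_hh_le le) auto
    then show "rnorm C m l \<gamma> (a + b) \<le> rnorm C m l \<gamma> a + rnorm C m l \<gamma> b + \<epsilon>" by simp
  qed
qed

lemma tendsto_rnorm_zero:
  assumes "((\<lambda>x. hh C m l \<gamma> (f x)) \<longlongrightarrow> 0) F"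
  shows "((\<lambda>x. rnorm C m l \<gamma> (f x)) \<longlongrightarrow> 0) F"
proof -
  have "((\<lambda>x. enn2real (hh C m l \<gamma> (f x))) \<longlongrightarrow> 0) F"
    using assms by (intro tendsto_enn2real) auto
  from tendsto_real_root[OF this, of "2 ^ m"] show ?thesis by (simp add: rnorm_eq_root)
qed

lemma fun_scale_apply [simp]: "fun_scale c a \<alpha> = c * a \<alpha>"
  by (simp add: fun_scale_def)

lemma vector_space_fun_scale: "vector_space fun_scale"
  by unfold_locales (auto simp: fun_eq_iff algebra_simps)

lemma subspace_nice_series: "module.subspace fun_scale (nice_series C)"
proof -
  interpret vector_space fun_scale by (rule vector_space_fun_scale)
  have "hh C m l \<gamma> 0 < top" for m l \<gamma>
    using hh_fun_scale[of C m l \<gamma> 0 0] by (simp add: power_0_left)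
  then have "0 \<in> nice_series C" unfolding nice_series_iff by blast
  moreover have "a + b \<in> nice_series C" if "a \<in> nice_series C" "b \<in> nice_series C" for a b
    unfolding nice_series_iff using hh_add_finite[OF hh_finite[OF that(1)] hh_finite[OF that(2)]] by blast
  moreover have "fun_scale c a \<in> nice_series C" if "a \<in> nice_series C" for c a
    using that unfolding nice_series_iff hh_fun_scale by (simp add: ennreal_mult_less_top)
  ultimately show ?thesis unfolding subspace_def by blast
qed

section \<open>The Frechet space of formal series\<close>

definition series_seminorms :: "('i \<Rightarrow> 'i \<Rightarrow> 'i \<Rightarrow> complex) \<Rightarrow> (('i \<Rightarrow> complex) \<Rightarrow> real) set" where
  "series_seminorms C = {rnorm C m l \<gamma> | m l \<gamma>. l < 2 ^ m}"

lemma rnorm_in_series_seminorms: "l < 2 ^ m \<Longrightarrow> rnorm C m l \<gamma> \<in> series_seminorms C"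
  unfolding series_seminorms_def by blast

lemma series_seminormsE:
  assumes "p \<in> series_seminorms C"
  obtains m l \<gamma> where "l < 2 ^ m" "p = rnorm C m l \<gamma>"
  using assms unfolding series_seminorms_def by blast

lemma series_topology_eq: "series_topology C = seminorm_topology (nice_series C) (series_seminorms C)"
  unfolding series_topology_def series_seminorms_def rnorm_def ..

interpretation series: seminorm_family fun_scale "nice_series C" "series_seminorms C" for C
proof (rule seminorm_family.intro)
  show "series_seminorms C \<noteq> {}" using rnorm_in_series_seminorms[of 0 0 C] by auto
  fix p assume "p \<in> series_seminorms C"
  then obtain m l \<gamma> where p: "l < 2 ^ m" "p = rnorm C m l \<gamma>" by (rule series_seminormsE)
  show "0 \<le> p x" for x unfolding p(2) by (rule rnorm_nonneg)
  show "p (x + y) \<le> p x + p y" if "x \<in> nice_series C" "y \<in> nice_series C" for x y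
    unfolding p(2) by (rule rnorm_triangle[OF hh_finite[OF that(1) p(1)] hh_finite[OF that(2) p(1)]])
  show "p (fun_scale c x) = cmod c * p x" for c x unfolding p(2) by (rule rnorm_fun_scale)
qed (rule vector_space_fun_scale subspace_nice_series)+

lemma topspace_series_topology: "topspace (series_topology C) = nice_series C"
  unfolding series_topology_eq by (rule series.topspace_T)

lemma limitin_series_topology_iff:
  "limitin (series_topology C) f a F \<longleftrightarrow> a \<in> nice_series C \<and> (\<forall>\<^sub>F x in F. f x \<in> nice_series C) \<and>
     (\<forall>m l \<gamma>. l < 2 ^ m \<longrightarrow> ((\<lambda>x. rnorm C m l \<gamma> (f x - a)) \<longlongrightarrow> 0) F)"
proof -
  have "(\<forall>p\<in>series_seminorms C. ((\<lambda>x. p (f x - a)) \<longlongrightarrow> 0) F) \<longleftrightarrow>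
      (\<forall>m l \<gamma>. l < 2 ^ m \<longrightarrow> ((\<lambda>x. rnorm C m l \<gamma> (f x - a)) \<longlongrightarrow> 0) F)" (is "?L \<longleftrightarrow> ?R")
  proof
    show ?R if ?L
      using bspec[OF that rnorm_in_series_seminorms] by blast
    show ?L if ?R
    proof
      fix p assume "p \<in> series_seminorms C"
      then obtain m l \<gamma> where p: "l < 2 ^ m" "p = rnorm C m l \<gamma>" by (rule series_seminormsE)
      show "((\<lambda>x. p (f x - a)) \<longlongrightarrow> 0) F" unfolding p(2) using that p(1) by blast
    qed
  qed
  then show ?thesis unfolding series_topology_eq series.limitin_iff by (simp only:)
qed

lemma continuous_map_coordinate: "continuous_map (series_topology C) euclidean (\<lambda>a. a \<alpha>)"
proof -
  have "((\<lambda>a. a \<alpha>) \<longlongrightarrow> b \<alpha>) (atin (series_topology C) b)" if "b \<in> nice_series C" for b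
  proof -
    have "limitin (series_topology C) (\<lambda>a. a) b (atin (series_topology C) b)"
      using continuous_map_id[of "series_topology C", unfolded continuous_map_atin] that
      by (simp add: topspace_series_topology id_def)
    then have "((\<lambda>a. rnorm C 0 0 \<alpha> (a - b)) \<longlongrightarrow> 0) (atin (series_topology C) b)"
      unfolding limitin_series_topology_iff by simp
    then have "((\<lambda>a. a \<alpha> - b \<alpha>) \<longlongrightarrow> 0) (atin (series_topology C) b)"
      unfolding rnorm_coordinate by (simp add: tendsto_norm_zero_iff)
    then show ?thesis by (rule Lim_null[THEN iffD2])
  qed
  then show ?thesis
    unfolding continuous_map_atin limitin_canonical_iff topspace_series_topology by blast
qed

lemma limitin_coordinate:
  assumes "limitin (series_topology C) f a F"
  shows "((\<lambda>x. f x \<alpha>) \<longlongrightarrow> a \<alpha>) F"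
  using continuous_map_limit[OF continuous_map_coordinate assms] by (simp add: o_def)

lemma series_topology_finer_than_product:
  assumes "openin (subtopology (product_topology (\<lambda>_. euclidean) UNIV) (nice_series C)) U"
  shows "openin (series_topology C) U"
proof -
  obtain W where W: "openin (product_topology (\<lambda>_. euclidean) UNIV) W" "U = W \<inter> nice_series C"
    using assms unfolding openin_subtopology by blast
  have "continuous_map (series_topology C) (product_topology (\<lambda>_. euclidean) UNIV) (\<lambda>a. a)"
    unfolding continuous_map_componentwise_UNIV by (intro allI continuous_map_coordinate)
  from openin_continuous_map_preimage[OF this W(1)]
  have "openin (series_topology C) {a \<in> nice_series C. a \<in> W}" by (simp add: topspace_series_topology)
  also have "{a \<in> nice_series C. a \<in> W} = U" using W(2) by blast
  finally show ?thesis .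
qed

text \<open>The coefficients of a Cauchy filter converge in the complex numbers. Lower semicontinuity turns a
  bound for \<open>x - y\<close>, valid for eventually all \<open>y\<close>, into the same bound for the difference of \<open>x\<close> to
  the coefficientwise limit. In particular that difference is nice, hence so is the limit.\<close>

lemma complete_series_topology: "complete_in (series_topology C)"
  unfolding complete_in_def
proof (intro allI impI)
  fix F assume F: "cauchy_filter_in (series_topology C) F"
  then have bot: "F \<noteq> bot" and "F \<le> principal (nice_series C)"
    unfolding cauchy_filter_in_def topspace_series_topology by blast+
  then have nice: "\<forall>\<^sub>F x in F. x \<in> nice_series C" by (simp add: le_principal)
  have small: "\<exists>S. eventually (\<lambda>x. x \<in> S) F \<and> (\<forall>x\<in>S. \<forall>y\<in>S. x - y \<in> nice_series C \<and> rnorm C m l \<gamma> (x - y) < \<epsilon>)"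
    if "\<epsilon> > 0" "l < 2 ^ m" for \<epsilon> m l \<gamma>
  proof -
    let ?U = "{y \<in> nice_series C. rnorm C m l \<gamma> (y - 0) < \<epsilon>}"
    have "openin (series_topology C) ?U"
      unfolding series_topology_eq
      by (rule series.openin_seminorm_ball[OF rnorm_in_series_seminorms[OF that(2)] series.zero_in])
    moreover have "rnorm C m l \<gamma> 0 = 0"
      by (rule series.seminorm_zero[OF rnorm_in_series_seminorms[OF that(2)]])
    then have "0 \<in> ?U" using that(1) series.zero_in by simp
    ultimately obtain S where "eventually (\<lambda>x. x \<in> S) F" "\<forall>x\<in>S. \<forall>y\<in>S. x - y \<in> ?U"
      using F unfolding cauchy_filter_in_def by blast
    then show ?thesis by auto
  qed
  have "\<exists>c. ((\<lambda>x. x \<alpha>) \<longlongrightarrow> c) F" for \<alpha>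
  proof -
    have "cauchy_filter (filtermap (\<lambda>x. x \<alpha>) F)"
      unfolding cauchy_filter_metric_filtermap
    proof (intro allI impI)
      fix \<epsilon> :: real assume "\<epsilon> > 0"
      then obtain S where S: "eventually (\<lambda>x. x \<in> S) F" "\<forall>x\<in>S. \<forall>y\<in>S. rnorm C 0 0 \<alpha> (x - y) < \<epsilon>"
        using small[of \<epsilon> 0 0 \<alpha>] by auto
      then show "\<exists>P. eventually P F \<and> (\<forall>x y. P x \<and> P y \<longrightarrow> dist (x \<alpha>) (y \<alpha>) < \<epsilon>)"
        by (intro exI[of _ "\<lambda>x. x \<in> S"]) (auto simp: rnorm_coordinate dist_norm)
    qed
    moreover have "filtermap (\<lambda>x. x \<alpha>) F \<noteq> bot" using bot by (simp add: filtermap_bot_iff)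
    ultimately obtain c where "filtermap (\<lambda>x. x \<alpha>) F \<le> nhds c"
      using cauchy_filter_complete_converges[OF _ complete_UNIV] by auto
    then show ?thesis unfolding filterlim_def by blast
  qed
  then obtain a where a: "\<And>\<alpha>. ((\<lambda>x. x \<alpha>) \<longlongrightarrow> a \<alpha>) F" by metis
  have close: "hh C m l \<gamma> (x - a) \<le> ennreal (\<epsilon> ^ 2 ^ m)"
    if S: "eventually (\<lambda>x. x \<in> S) F" "\<forall>x\<in>S. \<forall>y\<in>S. x - y \<in> nice_series C \<and> rnorm C m l \<gamma> (x - y) < \<epsilon>"
      and x: "x \<in> S" and l: "l < 2 ^ m" for S \<epsilon> m l \<gamma> x
  proof -
    have "((\<lambda>y. (x - y) \<alpha>) \<longlongrightarrow> (x - a) \<alpha>) F" for \<alpha>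
      unfolding fun_diff_def by (intro tendsto_intros a)
    then have "hh C m l \<gamma> (x - a) \<le> Liminf F (\<lambda>y. hh C m l \<gamma> (x - y))"
      by (rule hh_le_Liminf[OF bot])
    also have "\<dots> \<le> ennreal (\<epsilon> ^ 2 ^ m)"
    proof (rule Liminf_le[OF bot])
      show "\<forall>\<^sub>F y in F. hh C m l \<gamma> (x - y) \<le> ennreal (\<epsilon> ^ 2 ^ m)"
        using S(1)
      proof eventually_elim
        case (elim y)
        then have y: "x - y \<in> nice_series C" "rnorm C m l \<gamma> (x - y) < \<epsilon>" using S(2) x by auto
        have "rnorm C m l \<gamma> (x - y) ^ 2 ^ m \<le> \<epsilon> ^ 2 ^ m"
          using y(2) by (intro power_mono) auto
        then show ?case
          using hh_eq_rnorm_power[OF hh_finite[OF y(1) l], of \<gamma>] by (simp add: ennreal_leI)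
      qed
    qed
    finally show ?thesis .
  qed
  have a_nice: "a \<in> nice_series C"
    unfolding nice_series_iff
  proof (intro allI impI)
    fix m l :: nat and \<gamma> assume l: "l < 2 ^ m"
    obtain S where S: "eventually (\<lambda>x. x \<in> S) F"
      "\<forall>x\<in>S. \<forall>y\<in>S. x - y \<in> nice_series C \<and> rnorm C m l \<gamma> (x - y) < 1"
      using small[OF zero_less_one l] by blast
    have "\<forall>\<^sub>F x in F. x \<in> S \<and> x \<in> nice_series C" using S(1) nice by (rule eventually_conj)
    then obtain x where x: "x \<in> S" "x \<in> nice_series C"
      using bot eventually_happens by blast
    have "hh C m l \<gamma> (x - a) < top"
      using close[OF S x(1) l] by (rule order_le_less_trans) simp
    then have "hh C m l \<gamma> (fun_scale (- 1) (x - a)) < top"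
      unfolding hh_fun_scale by (simp add: ennreal_mult_less_top)
    then have "hh C m l \<gamma> (x + fun_scale (- 1) (x - a)) < top"
      by (rule hh_add_finite[OF hh_finite[OF x(2) l]])
    moreover have "x + fun_scale (- 1) (x - a) = a" by (simp add: fun_eq_iff)
    ultimately show "hh C m l \<gamma> a < top" by simp
  qed
  have "limitin (series_topology C) (\<lambda>x. x) a F"
    unfolding limitin_series_topology_iff
  proof (intro conjI allI impI)
    fix m l :: nat and \<gamma> assume l: "l < 2 ^ m"
    show "((\<lambda>x. rnorm C m l \<gamma> (x - a)) \<longlongrightarrow> 0) F"
    proof (rule tendstoI)
      fix \<epsilon> :: real assume \<epsilon>: "\<epsilon> > 0"
      then have "\<epsilon> / 2 > 0" by simp
      from small[OF this l] obtain S where S: "eventually (\<lambda>x. x \<in> S) F"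
        "\<forall>x\<in>S. \<forall>y\<in>S. x - y \<in> nice_series C \<and> rnorm C m l \<gamma> (x - y) < \<epsilon> / 2" by blast
      from S(1) show "\<forall>\<^sub>F x in F. dist (rnorm C m l \<gamma> (x - a)) 0 < \<epsilon>"
      proof eventually_elim
        case (elim x)
        have "rnorm C m l \<gamma> (x - a) \<le> \<epsilon> / 2"
          using \<epsilon> by (intro rnorm_le_if_hh_le close[OF S elim l]) simp
        then show ?case using \<epsilon> by (simp add: dist_real_def)
      qed
    qed
  qed (fact a_nice nice)+
  then show "\<exists>a. limitin (series_topology C) (\<lambda>x. x) a F" by blast
qed

lemma frechet_space_series_topology:
  fixes C :: "'i \<Rightarrow> 'i \<Rightarrow> 'i \<Rightarrow> complex"
  assumes "countable (UNIV :: 'i set)"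
  shows "frechet_space fun_scale (series_topology C)"
  unfolding frechet_space_def
proof (intro conjI)
  show "metrizable_space (series_topology C)"
    unfolding series_topology_eq
  proof (rule series.metrizable)
    have "series_seminorms C \<subseteq> (\<lambda>(m, l, \<gamma>). rnorm C m l \<gamma>) ` (UNIV \<times> UNIV \<times> UNIV)"
    proof
      fix p assume "p \<in> series_seminorms C"
      then obtain m l \<gamma> where p: "l < 2 ^ m" "p = rnorm C m l \<gamma>" by (rule series_seminormsE)
      then show "p \<in> (\<lambda>(m, l, \<gamma>). rnorm C m l \<gamma>) ` (UNIV \<times> UNIV \<times> UNIV)"
        by (intro image_eqI[of _ _ "(m, l, \<gamma>)"]) simp_all
    qed
    moreover have "countable ((\<lambda>(m, l, \<gamma>). rnorm C m l \<gamma>) ` (UNIV \<times> UNIV \<times> UNIV))"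
      by (intro countable_image countable_SIGMA assms uncountable_infinite) auto
    ultimately show "countable (series_seminorms C)" by (rule countable_subset)
    fix a assume "\<And>p. p \<in> series_seminorms C \<Longrightarrow> p a = 0"
    from this[OF rnorm_in_series_seminorms[of 0 0]] show "a = 0"
      by (simp add: rnorm_coordinate fun_eq_iff)
  qed
  show "topological_vector_space fun_scale (series_topology C)"
    unfolding series_topology_eq by (rule series.topological_vector_space)
  show "locally_convex fun_scale (series_topology C)"
    unfolding series_topology_eq by (rule series.locally_convex)
qed (rule complete_series_topology)

section \<open>The product of formal series\<close>

definition series_product ::
    "('i \<Rightarrow> 'i \<Rightarrow> 'i \<Rightarrow> complex) \<Rightarrow> ('i \<Rightarrow> complex) \<Rightarrow> ('i \<Rightarrow> complex) \<Rightarrow> 'i \<Rightarrow> complex" where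
  "series_product C a b = (\<lambda>\<gamma>. \<Sum>\<^sub>\<infinity>(\<alpha>, \<beta>). C \<alpha> \<beta> \<gamma> * (a \<alpha> * b \<beta>))"

text \<open>Cauchy--Schwarz for the weights \<open>\<bar>C \<alpha> \<beta> \<gamma>\<bar>\<close> on pairs, applied to \<open>\<bar>a \<alpha>\<bar>\<close> and \<open>\<bar>b \<beta>\<bar>\<close>. In the first
  factor the sum over \<open>\<beta>\<close> is carried out first, in the second factor the sum over \<open>\<alpha>\<close>; this produces
  the two functions \<open>h\<close> of level one.\<close>

lemma series_product_majorant:
  "(\<Sum>\<^sub>\<infinity>(\<alpha>, \<beta>). ennreal (cmod (C \<alpha> \<beta> \<gamma> * (a \<alpha> * b \<beta>))))\<^sup>2 \<le> hh C 1 0 \<gamma> a * hh C 1 1 \<gamma> b"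
proof -
  let ?w = "\<lambda>(\<alpha>, \<beta>). ennreal (cmod (C \<alpha> \<beta> \<gamma>))"
  let ?f = "\<lambda>(\<alpha>, \<beta>). ennreal (cmod (a \<alpha>))" and ?g = "\<lambda>(\<alpha>, \<beta>). ennreal (cmod (b \<beta>))"
  have "(\<Sum>\<^sub>\<infinity>(\<alpha>, \<beta>). ennreal (cmod (C \<alpha> \<beta> \<gamma> * (a \<alpha> * b \<beta>))))
      = (\<Sum>\<^sub>\<infinity>p. ?w p * (?f p * ?g p))"
    by (intro infsum_cong) (auto simp: norm_mult ennreal_mult)
  then have "(\<Sum>\<^sub>\<infinity>(\<alpha>, \<beta>). ennreal (cmod (C \<alpha> \<beta> \<gamma> * (a \<alpha> * b \<beta>))))\<^sup>2
      \<le> (\<Sum>\<^sub>\<infinity>p. ?w p * (?f p)\<^sup>2) * (\<Sum>\<^sub>\<infinity>p. ?w p * (?g p)\<^sup>2)"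
    by (simp only: infsum_Cauchy_Schwarz_ennreal)
  also have "\<dots> \<le> hh C 1 0 \<gamma> a * hh C 1 1 \<gamma> b"
  proof (intro mult_mono)
    have "(\<Sum>\<^sub>\<infinity>p. ?w p * (?f p)\<^sup>2) = (\<Sum>\<^sub>\<infinity>(\<alpha>, \<beta>). (ennreal (cmod (a \<alpha>)))\<^sup>2 * ennreal (cmod (C \<alpha> \<beta> \<gamma>)))"
      by (intro infsum_cong) (auto simp: mult.commute)
    also have "\<dots> \<le> (\<Sum>\<^sub>\<infinity>\<alpha>. \<Sum>\<^sub>\<infinity>\<beta>. (ennreal (cmod (a \<alpha>)))\<^sup>2 * ennreal (cmod (C \<alpha> \<beta> \<gamma>)))"
      by (rule infsum_product_le_ennreal(1))
    also have "\<dots> = hh C 1 0 \<gamma> a"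
      by (simp add: hh.simps(2) infsum_cmult_ennreal)
    finally show "(\<Sum>\<^sub>\<infinity>p. ?w p * (?f p)\<^sup>2) \<le> hh C 1 0 \<gamma> a" .
    have "(\<Sum>\<^sub>\<infinity>p. ?w p * (?g p)\<^sup>2) = (\<Sum>\<^sub>\<infinity>(\<alpha>, \<beta>). (ennreal (cmod (b \<beta>)))\<^sup>2 * ennreal (cmod (C \<alpha> \<beta> \<gamma>)))"
      by (intro infsum_cong) (auto simp: mult.commute)
    also have "\<dots> \<le> (\<Sum>\<^sub>\<infinity>\<beta>. \<Sum>\<^sub>\<infinity>\<alpha>. (ennreal (cmod (b \<beta>)))\<^sup>2 * ennreal (cmod (C \<alpha> \<beta> \<gamma>)))"
      by (rule infsum_product_le_ennreal(2))
    also have "\<dots> = hh C 1 1 \<gamma> b"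
      by (simp add: hh.simps(2) infsum_cmult_ennreal)
    finally show "(\<Sum>\<^sub>\<infinity>p. ?w p * (?g p)\<^sup>2) \<le> hh C 1 1 \<gamma> b" .
  qed auto
  finally show ?thesis .
qed

text \<open>The binary digits of \<open>l\<close> record the branches of the recursion: the lowest digit belongs to the
  outermost sum, the highest to the innermost one. Passing from \<open>a b\<close> to its factors inserts a new
  innermost step, which is the even one for \<open>a\<close> and the odd one for \<open>b\<close>. So the new top digit is \<open>0\<close>
  for \<open>a\<close> and \<open>1\<close> for \<open>b\<close>, while the outer sums are treated with Cauchy--Schwarz.\<close>

lemma hh_series_product:
  assumes "l < 2 ^ m"
  shows "(hh C m l \<gamma> (series_product C a b))\<^sup>2 \<le> hh C (Suc m) l \<gamma> a * hh C (Suc m) (2 ^ m + l) \<gamma> b"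
  using assms
proof (induction m arbitrary: l \<gamma>)
  case 0
  have "ennreal (cmod (series_product C a b \<gamma>)) \<le> (\<Sum>\<^sub>\<infinity>(\<alpha>, \<beta>). ennreal (cmod (C \<alpha> \<beta> \<gamma> * (a \<alpha> * b \<beta>))))"
    using norm_infsum_le_ennreal[of "\<lambda>(\<alpha>, \<beta>). C \<alpha> \<beta> \<gamma> * (a \<alpha> * b \<beta>)" UNIV]
    by (simp add: series_product_def case_prod_unfold)
  then have "(ennreal (cmod (series_product C a b \<gamma>)))\<^sup>2 \<le> (\<Sum>\<^sub>\<infinity>(\<alpha>, \<beta>). ennreal (cmod (C \<alpha> \<beta> \<gamma> * (a \<alpha> * b \<beta>))))\<^sup>2"
    by (intro power_mono) auto
  also note series_product_majorant
  finally show ?case using 0 by simp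
next
  case (Suc m)
  let ?w = "weight C l \<gamma>"
  let ?A = "\<lambda>\<alpha>. hh C (Suc m) (l div 2) \<alpha> a" and ?B = "\<lambda>\<alpha>. hh C (Suc m) (2 ^ m + l div 2) \<alpha> b"
  have "l div 2 < 2 ^ m" using Suc.prems by auto
  note IH = Suc.IH[OF this]
  have "(hh C (Suc m) l \<gamma> (series_product C a b))\<^sup>2 \<le> (\<Sum>\<^sub>\<infinity>\<alpha>. ?w \<alpha> * (?A \<alpha> * ?B \<alpha>))\<^sup>2"
    unfolding hh_Suc_weight[of C m l \<gamma> "series_product C a b"] by (intro power_mono infsum_mono_ennreal mult_left_mono IH) auto
  also have "\<dots> \<le> (\<Sum>\<^sub>\<infinity>\<alpha>. ?w \<alpha> * (?A \<alpha>)\<^sup>2) * (\<Sum>\<^sub>\<infinity>\<alpha>. ?w \<alpha> * (?B \<alpha>)\<^sup>2)"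
    by (rule infsum_Cauchy_Schwarz_ennreal)
  also have "(\<Sum>\<^sub>\<infinity>\<alpha>. ?w \<alpha> * (?A \<alpha>)\<^sup>2) = hh C (Suc (Suc m)) l \<gamma> a"
    by (rule hh_Suc_weight[symmetric])
  also have "(\<Sum>\<^sub>\<infinity>\<alpha>. ?w \<alpha> * (?B \<alpha>)\<^sup>2) = hh C (Suc (Suc m)) (2 ^ Suc m + l) \<gamma> b"
  proof -
    have "weight C (2 ^ Suc m + l) \<gamma> = ?w" by (simp add: weight_def fun_eq_iff)
    moreover have "(2 ^ Suc m + l) div 2 = 2 ^ m + l div 2" by simp
    ultimately show ?thesis unfolding hh_Suc_weight[of C "Suc m" "2 ^ Suc m + l"] by simp
  qed
  finally show ?case .
qed

text \<open>The inequality for \<open>h\<close> is homogeneous of degree \<open>2 ^ Suc m\<close> on both sides, so taking roots gives the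
  estimate for the seminorms. The majorant of the double series is finite by the case of level zero.\<close>

lemma
  assumes a: "a \<in> nice_series C" and b: "b \<in> nice_series C"
  shows series_product_nice: "series_product C a b \<in> nice_series C"
    and rnorm_series_product: "l < 2 ^ m \<Longrightarrow>
      rnorm C m l \<gamma> (series_product C a b) \<le> rnorm C (Suc m) l \<gamma> a * rnorm C (Suc m) (2 ^ m + l) \<gamma> b"
    and series_product_summable:
      "(\<lambda>(\<alpha>, \<beta>). C \<alpha> \<beta> \<gamma> * (a \<alpha> * b \<beta>)) summable_on UNIV"
proof -
  have fin: "hh C m l \<gamma> (series_product C a b) < top"
    and le: "rnorm C m l \<gamma> (series_product C a b) \<le> rnorm C (Suc m) l \<gamma> a * rnorm C (Suc m) (2 ^ m + l) \<gamma> b"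
    if l: "l < 2 ^ m" for m l \<gamma>
  proof -
    let ?x = "rnorm C (Suc m) l \<gamma> a" and ?y = "rnorm C (Suc m) (2 ^ m + l) \<gamma> b"
    have "hh C (Suc m) l \<gamma> a * hh C (Suc m) (2 ^ m + l) \<gamma> b
        = ennreal (?x ^ 2 ^ Suc m) * ennreal (?y ^ 2 ^ Suc m)"
      using hh_eq_rnorm_power[OF hh_finite[OF a], of l "Suc m" \<gamma>]
        hh_eq_rnorm_power[OF hh_finite[OF b], of "2 ^ m + l" "Suc m" \<gamma>] l by simp
    also have "\<dots> = ennreal ((?x * ?y) ^ 2 ^ Suc m)"
      by (simp only: ennreal_mult[symmetric] power_mult_distrib rnorm_nonneg zero_le_power)
    finally have sq: "(hh C m l \<gamma> (series_product C a b))\<^sup>2 \<le> ennreal ((?x * ?y) ^ 2 ^ Suc m)"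
      using hh_series_product[OF l, of C \<gamma> a b] by (simp only:)
    then have "(hh C m l \<gamma> (series_product C a b))\<^sup>2 < top"
      by (rule order_le_less_trans) simp
    then show fin: "hh C m l \<gamma> (series_product C a b) < top"
      by (simp add: power_less_top_ennreal)
    let ?r = "rnorm C m l \<gamma> (series_product C a b)"
    have "ennreal (?r ^ 2 ^ Suc m) = (hh C m l \<gamma> (series_product C a b))\<^sup>2"
      unfolding hh_eq_rnorm_power[OF fin] by (simp add: ennreal_power power_mult[symmetric] mult.commute)
    then have "ennreal (?r ^ 2 ^ Suc m) \<le> ennreal ((?x * ?y) ^ 2 ^ Suc m)" using sq by (simp only:)
    moreover have "0 \<le> (?x * ?y) ^ 2 ^ Suc m"
      by (intro zero_le_power mult_nonneg_nonneg rnorm_nonneg)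
    ultimately have "?r ^ 2 ^ Suc m \<le> (?x * ?y) ^ 2 ^ Suc m"
      by (simp only: ennreal_le_iff)
    moreover have "?r ^ 2 ^ Suc m \<le> (?x * ?y) ^ 2 ^ Suc m \<longleftrightarrow> ?r \<le> ?x * ?y"
      by (rule power_mono_iff) (auto intro: mult_nonneg_nonneg)
    ultimately show "?r \<le> ?x * ?y" by (simp only:)
  qed
  show "series_product C a b \<in> nice_series C" unfolding nice_series_iff using fin by blast
  show "rnorm C m l \<gamma> (series_product C a b) \<le> rnorm C (Suc m) l \<gamma> a * rnorm C (Suc m) (2 ^ m + l) \<gamma> b"
    if "l < 2 ^ m" by (rule le[OF that])
  have "hh C 1 0 \<gamma> a * hh C 1 1 \<gamma> b < top"
    using hh_finite[OF a, of 0 1] hh_finite[OF b, of 1 1] by (simp add: ennreal_mult_less_top)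
  then have "(\<Sum>\<^sub>\<infinity>(\<alpha>, \<beta>). ennreal (cmod (C \<alpha> \<beta> \<gamma> * (a \<alpha> * b \<beta>))))\<^sup>2 < top"
    by (rule order_le_less_trans[OF series_product_majorant])
  then have "(\<Sum>\<^sub>\<infinity>(\<alpha>, \<beta>). ennreal (cmod (C \<alpha> \<beta> \<gamma> * (a \<alpha> * b \<beta>)))) < top"
    by (simp add: power_less_top_ennreal)
  then have "(\<Sum>\<^sub>\<infinity>p. ennreal (cmod ((\<lambda>(\<alpha>, \<beta>). C \<alpha> \<beta> \<gamma> * (a \<alpha> * b \<beta>)) p))) < top"
    by (simp add: case_prod_unfold)
  then show "(\<lambda>(\<alpha>, \<beta>). C \<alpha> \<beta> \<gamma> * (a \<alpha> * b \<beta>)) summable_on UNIV"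
    by (rule abs_summable_summable[OF abs_summable_on_if_infsum_ennreal_finite])
qed

lemma bilinear_series_product: "bilinear_product_on fun_scale (nice_series C) (series_product C)"
proof -
  have addr: "series_product C a (b + c) = series_product C a b + series_product C a c"
    if "a \<in> nice_series C" "b \<in> nice_series C" "c \<in> nice_series C" for a b c
  proof
    fix \<gamma>
    show "series_product C a (b + c) \<gamma> = (series_product C a b + series_product C a c) \<gamma>"
      using infsum_add[OF series_product_summable[OF that(1,2), of \<gamma>] series_product_summable[OF that(1,3), of \<gamma>]]
      by (simp add: series_product_def case_prod_unfold distrib_left)
  qed
  have addl: "series_product C (b + c) a = series_product C b a + series_product C c a"
    if "a \<in> nice_series C" "b \<in> nice_series C" "c \<in> nice_series C" for a b c
  proof
    fix \<gamma>
    show "series_product C (b + c) a \<gamma> = (series_product C b a + series_product C c a) \<gamma>"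
      using infsum_add[OF series_product_summable[OF that(2,1), of \<gamma>] series_product_summable[OF that(3,1), of \<gamma>]]
      by (simp add: series_product_def case_prod_unfold distrib_left distrib_right)
  qed
  have scale: "series_product C a (fun_scale c b) = fun_scale c (series_product C a b)"
    "series_product C (fun_scale c a) b = fun_scale c (series_product C a b)" for a b c
    unfolding fun_eq_iff series_product_def fun_scale_apply infsum_cmult_right'[symmetric]
    by (auto simp: algebra_simps intro!: infsum_cong)
  show ?thesis
    unfolding bilinear_product_on_def linear_on_def
    using addr addl scale series_product_nice by blast
qed

lemma continuous_series_product:
  "continuous_map (prod_topology (series_topology C) (series_topology C)) (series_topology C)
     (\<lambda>(a, b). series_product C a b)"
  unfolding continuous_map_atin
proof (intro ballI)
  let ?X = "prod_topology (series_topology C) (series_topology C)"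
  let ?V = "nice_series C" and ?P = "series_product C"
  have bil: "?P (a + b) c = ?P a c + ?P b c" "?P c (a + b) = ?P c a + ?P c b"
    if "a \<in> ?V" "b \<in> ?V" "c \<in> ?V" for a b c
    using bilinear_series_product[of C] that unfolding bilinear_product_on_def linear_on_def by blast+
  fix z assume z: "z \<in> topspace ?X"
  obtain a b where ab: "z = (a, b)" "a \<in> ?V" "b \<in> ?V"
    using z by (cases z) (auto simp: topspace_series_topology)
  have lim: "limitin (series_topology C) fst a (atin ?X z)" "limitin (series_topology C) snd b (atin ?X z)"
    using continuous_map_fst[of "series_topology C" "series_topology C"]
      continuous_map_snd[of "series_topology C" "series_topology C"] z
    unfolding continuous_map_atin ab(1) by fastforce+
  have ev: "\<forall>\<^sub>F w in atin ?X z. fst w \<in> ?V \<and> snd w \<in> ?V"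
    using eventually_atin_topspace by eventually_elim (auto simp: topspace_series_topology)
  have "limitin (series_topology C) (\<lambda>w. ?P (fst w) (snd w)) (?P a b) (atin ?X z)"
    unfolding limitin_series_topology_iff
  proof (intro conjI allI impI)
    show "?P a b \<in> ?V" using ab by (intro series_product_nice)
    show "\<forall>\<^sub>F w in atin ?X z. ?P (fst w) (snd w) \<in> ?V"
      using ev by eventually_elim (simp add: series_product_nice)
    fix m l :: nat and \<gamma> assume l: "l < 2 ^ m"
    let ?M = "rnorm C (Suc m) l \<gamma>" and ?N = "rnorm C (Suc m) (2 ^ m + l) \<gamma>"
    have l': "l < 2 ^ Suc m" "2 ^ m + l < 2 ^ Suc m" using l by simp_all
    have M0: "((\<lambda>w. ?M (fst w - a)) \<longlongrightarrow> 0) (atin ?X z)" and N0: "((\<lambda>w. ?N (snd w - b)) \<longlongrightarrow> 0) (atin ?X z)"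
      using lim l' unfolding limitin_series_topology_iff by blast+
    show "((\<lambda>w. rnorm C m l \<gamma> (?P (fst w) (snd w) - ?P a b)) \<longlongrightarrow> 0) (atin ?X z)"
    proof (rule tendsto_sandwich[OF _ _ tendsto_const])
      show "\<forall>\<^sub>F w in atin ?X z. 0 \<le> rnorm C m l \<gamma> (?P (fst w) (snd w) - ?P a b)" by simp
      show "\<forall>\<^sub>F w in atin ?X z. rnorm C m l \<gamma> (?P (fst w) (snd w) - ?P a b)
          \<le> ?M (fst w - a) * (?N (snd w - b) + ?N b) + ?M a * ?N (snd w - b)"
        using ev
      proof eventually_elim
        case (elim w)
        define x y where "x = fst w - a" and "y = snd w - b"
        have xy: "x \<in> ?V" "y \<in> ?V" unfolding x_def y_def using elim ab series.diff_in by blast+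
        have w: "fst w = x + a" "snd w = y + b" by (simp_all add: x_def y_def)
        have "?P (fst w) (snd w) - ?P a b = ?P x (y + b) + ?P a y"
          unfolding w using bil(1)[OF xy(1) ab(2) series.add_in[OF xy(2) ab(3)]] bil(2)[OF xy(2) ab(3) ab(2)]
          by simp
        then have "rnorm C m l \<gamma> (?P (fst w) (snd w) - ?P a b)
            \<le> rnorm C m l \<gamma> (?P x (y + b)) + rnorm C m l \<gamma> (?P a y)"
          using series.triangle[OF rnorm_in_series_seminorms[OF l]
              series_product_nice[OF xy(1) series.add_in[OF xy(2) ab(3)]] series_product_nice[OF ab(2) xy(2)]]
          by (simp only:)
        also have "\<dots> \<le> ?M x * ?N (y + b) + ?M a * ?N y"
          by (intro add_mono rnorm_series_product l xy ab series.add_in)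
        also have "\<dots> \<le> ?M x * (?N y + ?N b) + ?M a * ?N y"
          by (intro add_right_mono mult_left_mono rnorm_nonneg
              series.triangle[OF rnorm_in_series_seminorms[OF l'(2)] xy(2) ab(3)])
        finally show ?case by (simp add: x_def y_def)
      qed
      have "((\<lambda>w. ?M (fst w - a) * (?N (snd w - b) + ?N b) + ?M a * ?N (snd w - b))
          \<longlongrightarrow> 0 * (0 + ?N b) + ?M a * 0) (atin ?X z)"
        by (intro tendsto_intros M0 N0)
      then show "((\<lambda>w. ?M (fst w - a) * (?N (snd w - b) + ?N b) + ?M a * ?N (snd w - b)) \<longlongrightarrow> 0) (atin ?X z)"
        by simp
    qed
  qed
  then show "limitin (series_topology C) (\<lambda>(a, b). ?P a b) ((\<lambda>(a, b). ?P a b) z) (atin ?X z)"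
    by (simp add: case_prod_unfold ab(1))
qed

section \<open>Unit series\<close>

text \<open>Dominated convergence at each level of the recursion, with the terms of the sum for \<open>a\<close> itself as a
  majorant. The finite weights let every single term tend to zero.\<close>

lemma hh_tail_tendsto_zero:
  assumes w: "\<And>l \<gamma> \<alpha>. weight C l \<gamma> \<alpha> < top" and a: "a \<in> nice_series C" and "l < 2 ^ m"
  shows "((\<lambda>F. hh C m l \<gamma> (\<lambda>\<alpha>. if \<alpha> \<in> F then 0 else a \<alpha>)) \<longlongrightarrow> 0) (finite_subsets_at_top UNIV)"
  using assms(3)
proof (induction m arbitrary: l \<gamma>)
  case 0
  have "\<forall>\<^sub>F F in finite_subsets_at_top UNIV. {\<gamma>} \<subseteq> F"
    unfolding eventually_finite_subsets_at_top by (rule exI[of _ "{\<gamma>}"]) simp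
  then have "\<forall>\<^sub>F F in finite_subsets_at_top UNIV. hh C 0 l \<gamma> (\<lambda>\<alpha>. if \<alpha> \<in> F then 0 else a \<alpha>) = 0"
    by eventually_elim simp
  then show ?case by (rule tendsto_eventually)
next
  case (Suc m)
  then have l: "l div 2 < 2 ^ m" by auto
  show ?case
    unfolding hh_Suc_weight
  proof (rule infsum_dominated_to_zero_ennreal)
    show "weight C l \<gamma> \<alpha> * (hh C m (l div 2) \<alpha> (\<lambda>\<alpha>. if \<alpha> \<in> F then 0 else a \<alpha>))\<^sup>2
        \<le> weight C l \<gamma> \<alpha> * (hh C m (l div 2) \<alpha> a)\<^sup>2" for F \<alpha>
      by (intro mult_left_mono power_mono hh_mono) auto
    show "(\<Sum>\<^sub>\<infinity>\<alpha>. weight C l \<gamma> \<alpha> * (hh C m (l div 2) \<alpha> a)\<^sup>2) < top"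
      using hh_finite[OF a Suc.prems] unfolding hh_Suc_weight .
    fix \<alpha>
    let ?h = "\<lambda>F. hh C m (l div 2) \<alpha> (\<lambda>\<alpha>. if \<alpha> \<in> F then 0 else a \<alpha>)"
    have "((\<lambda>F. weight C l \<gamma> \<alpha> * (?h F * ?h F)) \<longlongrightarrow> weight C l \<gamma> \<alpha> * (0 * 0)) (finite_subsets_at_top UNIV)"
    proof (intro tendsto_mult_ennreal tendsto_const)
      show "(?h \<longlongrightarrow> 0) (finite_subsets_at_top UNIV)" "(?h \<longlongrightarrow> 0) (finite_subsets_at_top UNIV)"
        by (rule Suc.IH[OF l])+
    qed (use w[of l \<gamma> \<alpha>] in auto)
    then show "((\<lambda>F. weight C l \<gamma> \<alpha> * (?h F)\<^sup>2) \<longlongrightarrow> 0) (finite_subsets_at_top UNIV)"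
      by (simp add: power2_eq_square)
  qed
qed

definition unit_series :: "'i \<Rightarrow> 'i \<Rightarrow> complex" where
  "unit_series \<alpha> = (\<lambda>\<beta>. if \<beta> = \<alpha> then 1 else 0)"

lemma sum_unit_series_apply:
  "finite F \<Longrightarrow> (\<Sum>\<alpha>\<in>F. fun_scale (a \<alpha>) (unit_series \<alpha>)) \<beta> = (if \<beta> \<in> F then a \<beta> else 0)"
  by (induction F rule: finite_induct) (auto simp: unit_series_def)

lemma unit_series_expansion:
  assumes w: "\<And>l \<gamma> \<alpha>. weight C l \<gamma> \<alpha> < top" and a: "a \<in> nice_series C"
  shows "converges_unconditionally (series_topology C) (\<lambda>\<alpha>. fun_scale (a \<alpha>) (unit_series \<alpha>)) a"
  unfolding converges_unconditionally_def limitin_series_topology_iff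
proof (intro conjI allI impI)
  let ?F = "finite_subsets_at_top UNIV :: 'a set filter"
  let ?s = "\<lambda>F. \<Sum>\<alpha>\<in>F. fun_scale (a \<alpha>) (unit_series \<alpha>)"
  show "a \<in> nice_series C" by fact
  show "\<forall>\<^sub>F F in ?F. ?s F \<in> nice_series C"
  proof (rule eventually_finite_subsets_at_top_weakI)
    fix F :: "'a set" assume "finite F"
    then have "cmod (?s F \<beta>) \<le> cmod (a \<beta>)" for \<beta> by (simp add: sum_unit_series_apply)
    then have "hh C m l \<gamma> (?s F) \<le> hh C m l \<gamma> a" for m l \<gamma> by (rule hh_mono)
    then show "?s F \<in> nice_series C"
      unfolding nice_series_iff using order_le_less_trans[OF _ hh_finite[OF a]] by blast
  qed
  fix m l :: nat and \<gamma> assume l: "l < 2 ^ m"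
  have "((\<lambda>F. rnorm C m l \<gamma> (\<lambda>\<alpha>. if \<alpha> \<in> F then 0 else a \<alpha>)) \<longlongrightarrow> 0) ?F"
    by (rule tendsto_rnorm_zero[OF hh_tail_tendsto_zero[OF w a l]])
  moreover have "\<forall>\<^sub>F F in ?F. rnorm C m l \<gamma> (\<lambda>\<alpha>. if \<alpha> \<in> F then 0 else a \<alpha>) = rnorm C m l \<gamma> (?s F - a)"
  proof (rule eventually_finite_subsets_at_top_weakI)
    fix F :: "'a set" assume "finite F"
    then have "?s F - a = fun_scale (- 1) (\<lambda>\<alpha>. if \<alpha> \<in> F then 0 else a \<alpha>)"
      by (auto simp: fun_eq_iff sum_unit_series_apply)
    then show "rnorm C m l \<gamma> (\<lambda>\<alpha>. if \<alpha> \<in> F then 0 else a \<alpha>) = rnorm C m l \<gamma> (?s F - a)"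
      by (simp add: rnorm_fun_scale)
  qed
  ultimately show "((\<lambda>F. rnorm C m l \<gamma> (?s F - a)) \<longlongrightarrow> 0) ?F"
    by (rule Lim_transform_eventually)
qed

text \<open>An enumeration exhausts the index set by finite subsets, so unconditional convergence gives
  convergence of the partial sums. The coefficients are unique because coordinates are continuous
  and each one is constant along the partial sums from some point on.\<close>

lemma unit_series_unconditional_basis:
  fixes C :: "'i \<Rightarrow> 'i \<Rightarrow> 'i \<Rightarrow> complex"
  assumes w: "\<And>l \<gamma> \<alpha>. weight C l \<gamma> \<alpha> < top" and nice: "\<And>\<alpha>. unit_series \<alpha> \<in> nice_series C"
  shows "unconditional_schauder_basis fun_scale (series_topology C) unit_series"
  unfolding unconditional_schauder_basis_def topspace_series_topology
proof (intro conjI allI ballI impI)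
  show "\<exists>c. converges_unconditionally (series_topology C) (\<lambda>\<alpha>. fun_scale (c \<alpha>) (unit_series \<alpha>)) a"
    if "a \<in> nice_series C" for a
    using unit_series_expansion[OF w that] by blast
  fix \<sigma> :: "nat \<Rightarrow> 'i" assume \<sigma>: "bij \<sigma>"
  then have inj: "inj_on \<sigma> A" for A by (meson bij_is_inj inj_on_subset subset_UNIV)
  have sum_eq: "(\<Sum>k<n. fun_scale (c (\<sigma> k)) (unit_series (\<sigma> k))) = (\<Sum>\<alpha>\<in>\<sigma> ` {..<n}. fun_scale (c \<alpha>) (unit_series \<alpha>))" for c n
    by (simp add: sum.reindex[OF inj])
  show "schauder_basis fun_scale (series_topology C) (\<lambda>n. unit_series (\<sigma> n))"
    unfolding schauder_basis_def topspace_series_topology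
  proof (intro conjI ballI)
    show "range (\<lambda>n. unit_series (\<sigma> n)) \<subseteq> nice_series C" using nice by blast
    fix a assume a: "a \<in> nice_series C"
    show "\<exists>!c. limitin (series_topology C) (\<lambda>n. \<Sum>k<n. fun_scale (c k) (unit_series (\<sigma> k))) a sequentially"
    proof
      have seq: "filterlim (\<lambda>n. \<sigma> ` {..<n}) (finite_subsets_at_top UNIV) sequentially"
        unfolding filterlim_finite_subsets_at_top
      proof (intro allI impI)
        fix X :: "'i set" assume X: "finite X \<and> X \<subseteq> UNIV"
        then have "finite (inv \<sigma> ` X)" by simp
        then obtain N where N: "inv \<sigma> ` X \<subseteq> {..<N}" by (auto simp: finite_nat_iff_bounded)
        have "X \<subseteq> \<sigma> ` {..<n}" if "n \<ge> N" for n
        proof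
          fix x assume "x \<in> X"
          then have "inv \<sigma> x < n" using N that by auto
          moreover have "\<sigma> (inv \<sigma> x) = x" using \<sigma> by (simp add: bij_is_surj surj_f_inv_f)
          ultimately show "x \<in> \<sigma> ` {..<n}" by (metis image_eqI lessThan_iff)
        qed
        then show "\<forall>\<^sub>F n in sequentially. finite (\<sigma> ` {..<n}) \<and> X \<subseteq> \<sigma> ` {..<n} \<and> \<sigma> ` {..<n} \<subseteq> UNIV"
          by (intro eventually_sequentiallyI[of N]) simp
      qed
      have lim: "limitin (series_topology C) (\<lambda>F. \<Sum>\<alpha>\<in>F. fun_scale (a \<alpha>) (unit_series \<alpha>)) a (finite_subsets_at_top UNIV)"
        using unit_series_expansion[OF w a] unfolding converges_unconditionally_def .
      have "limitin (series_topology C) (\<lambda>n. \<Sum>\<alpha>\<in>\<sigma> ` {..<n}. fun_scale (a \<alpha>) (unit_series \<alpha>)) a sequentially"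
        unfolding limitin_def
      proof (intro conjI allI impI)
        show "a \<in> topspace (series_topology C)" using a by (simp add: topspace_series_topology)
        fix U assume "openin (series_topology C) U \<and> a \<in> U"
        then have "\<forall>\<^sub>F F in finite_subsets_at_top UNIV. (\<Sum>\<alpha>\<in>F. fun_scale (a \<alpha>) (unit_series \<alpha>)) \<in> U"
          using limitinD[OF lim, of U] by simp
        from eventually_compose_filterlim[OF this seq]
        show "\<forall>\<^sub>F n in sequentially. (\<Sum>\<alpha>\<in>\<sigma> ` {..<n}. fun_scale (a \<alpha>) (unit_series \<alpha>)) \<in> U" .
      qed
      then show "limitin (series_topology C) (\<lambda>n. \<Sum>k<n. fun_scale (a (\<sigma> k)) (unit_series (\<sigma> k))) a sequentially"
        unfolding sum_eq .
    next
      fix c assume lim: "limitin (series_topology C) (\<lambda>n. \<Sum>k<n. fun_scale (c k) (unit_series (\<sigma> k))) a sequentially"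
      show "c = (\<lambda>k. a (\<sigma> k))"
      proof
        fix k
        have c: "(c \<circ> inv \<sigma>) (\<sigma> j) = c j" for j using \<sigma> by (simp add: bij_is_inj)
        have "(\<Sum>j<n. fun_scale (c j) (unit_series (\<sigma> j))) (\<sigma> k) = c k" if "n > k" for n
        proof -
          have "\<sigma> k \<in> \<sigma> ` {..<n}" using that by blast
          then show ?thesis
            using sum_unit_series_apply[of "\<sigma> ` {..<n}" "c \<circ> inv \<sigma>" "\<sigma> k"]
            unfolding sum_eq[of "c \<circ> inv \<sigma>" n, symmetric] c by simp
        qed
        then have "\<forall>\<^sub>F n in sequentially. (\<Sum>j<n. fun_scale (c j) (unit_series (\<sigma> j))) (\<sigma> k) = c k"
          by (intro eventually_sequentiallyI[of "Suc k"]) simp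
        then have "(\<lambda>n. (\<Sum>j<n. fun_scale (c j) (unit_series (\<sigma> j))) (\<sigma> k)) \<longlonglongrightarrow> c k"
          by (rule tendsto_eventually)
        then show "c k = a (\<sigma> k)"
          using limitin_coordinate[OF lim, of "\<sigma> k"] by (rule LIMSEQ_unique)
      qed
    qed
  qed
qed

text \<open>The weight of \<open>\<alpha>\<close> is the value of \<open>h\<close> of level one at the unit series of \<open>\<alpha>\<close>; reducing \<open>l\<close> modulo
  two keeps the parity and gives an admissible index for level one.\<close>

lemma weight_finite_if_unit_series_nice:
  assumes "\<And>\<alpha>. unit_series \<alpha> \<in> nice_series C"
  shows "weight C l \<gamma> \<alpha> < top"
proof -
  have "weight C l \<gamma> \<alpha> = (\<Sum>\<beta>\<in>{\<alpha>}. weight C (l mod 2) \<gamma> \<beta> * (hh C 0 (l mod 2 div 2) \<beta> (unit_series \<alpha>))\<^sup>2)"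
    by (simp add: unit_series_def weight_def even_iff_mod_2_eq_zero)
  also have "\<dots> \<le> hh C (Suc 0) (l mod 2) \<gamma> (unit_series \<alpha>)"
    unfolding hh_Suc_weight by (rule sum_le_infsum_ennreal) auto
  also have "\<dots> < top" by (rule hh_finite[OF assms]) simp
  finally show ?thesis .
qed

section \<open>Algebras with a distinguished basis\<close>

lemma linear_on_UNIV_sum:
  fixes f :: "'v::ab_group_add \<Rightarrow> 'w::ab_group_add"
  assumes "linear_on r s UNIV f"
  shows "f (\<Sum>i\<in>A. r (c i) (v i)) = (\<Sum>i\<in>A. s (c i) (f (v i)))"
proof (induction A rule: infinite_finite_induct)
  have add: "f (x + y) = f x + f y" for x y using assms by (simp add: linear_on_def)
  have zero: "f 0 = 0" using add[of 0 0] by simp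
  show "f (\<Sum>i\<in>{}. r (c i) (v i)) = (\<Sum>i\<in>{}. s (c i) (f (v i)))" using zero by simp
  show "f (\<Sum>i\<in>A. r (c i) (v i)) = (\<Sum>i\<in>A. s (c i) (f (v i)))" if "infinite A" for A using zero that by simp
  fix x A assume "finite A" "x \<notin> A" and IH: "f (\<Sum>i\<in>A. r (c i) (v i)) = (\<Sum>i\<in>A. s (c i) (f (v i)))"
  then show "f (\<Sum>i\<in>insert x A. r (c i) (v i)) = (\<Sum>i\<in>insert x A. s (c i) (f (v i)))"
    using assms add by (simp add: linear_on_def)
qed

context
  fixes scale :: "complex \<Rightarrow> 'a \<Rightarrow> 'a::ab_group_add" and e :: "'i \<Rightarrow> 'a"
  assumes vs: "vector_space scale" and basis: "basis_family scale e"
begin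

interpretation vector_space scale by (fact vs)

lemma basis_facts: "inj e" "independent (range e)" "span (range e) = UNIV"
  using basis unfolding basis_family_def by blast+

lemma linear_to_series: "linear_on scale fun_scale UNIV (to_series scale e)"
  unfolding linear_on_def to_series_def basis_coeff_def fun_scale_def
  using basis_facts by (simp add: representation_add representation_scale fun_eq_iff)

lemma to_series_basis: "to_series scale e (e \<alpha>) = unit_series \<alpha>"
  unfolding to_series_def basis_coeff_def unit_series_def
  using representation_basis[OF basis_facts(2), of "e \<alpha>"] inj_eq[OF basis_facts(1)] by (simp add: fun_eq_iff)

lemma finite_support_to_series: "finite {\<alpha>. to_series scale e x \<alpha> \<noteq> 0}"
proof -
  have "{\<alpha>. to_series scale e x \<alpha> \<noteq> 0} = e -` {b. representation (range e) x b \<noteq> 0}"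
    by (auto simp: to_series_def basis_coeff_def)
  then show ?thesis
    using finite_vimageI[OF finite_representation basis_facts(1)] by simp
qed

lemma basis_expansion:
  "x = (\<Sum>\<alpha> | to_series scale e x \<alpha> \<noteq> 0. scale (to_series scale e x \<alpha>) (e \<alpha>))"
proof -
  have "{b. representation (range e) x b \<noteq> 0} = e ` {\<alpha>. to_series scale e x \<alpha> \<noteq> 0}"
    using representation_ne_zero[of "range e" x] by (auto simp: to_series_def basis_coeff_def)
  then have "x = (\<Sum>b\<in>e ` {\<alpha>. to_series scale e x \<alpha> \<noteq> 0}. scale (representation (range e) x b) b)"
    using sum_nonzero_representation_eq[OF basis_facts(2), of x] basis_facts(3) by simp
  also have "\<dots> = (\<Sum>\<alpha> | to_series scale e x \<alpha> \<noteq> 0. scale (to_series scale e x \<alpha>) (e \<alpha>))"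
    by (subst sum.reindex[OF inj_on_subset[OF basis_facts(1) subset_UNIV]])
       (simp add: to_series_def basis_coeff_def)
  finally show ?thesis .
qed

lemma inj_to_series: "inj (to_series scale e)"
proof (rule injI)
  fix x y assume eq: "to_series scale e x = to_series scale e y"
  have "x = (\<Sum>\<alpha> | to_series scale e x \<alpha> \<noteq> 0. scale (to_series scale e x \<alpha>) (e \<alpha>))"
    by (rule basis_expansion)
  also have "\<dots> = y" unfolding eq by (rule basis_expansion[symmetric])
  finally show "x = y" .
qed

lemma sum_unit_series_in_range:
  "(\<Sum>\<alpha>\<in>F. fun_scale (a \<alpha>) (unit_series \<alpha>)) \<in> range (to_series scale e)"
  using linear_on_UNIV_sum[OF linear_to_series, of a e F, symmetric] unfolding to_series_basis by blast

text \<open>Both factors have finite support, so bilinearity reduces the product to the products of basis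
  vectors, and the infinite double sum is a finite one.\<close>

lemma to_series_product:
  assumes bil: "bilinear_product_on scale UNIV star"
  shows "to_series scale e (star x y) =
    series_product (struct_const scale star e) (to_series scale e x) (to_series scale e y)"
proof
  fix \<gamma>
  let ?t = "to_series scale e" and ?C = "struct_const scale star e"
  let ?S = "\<lambda>x. {\<alpha>. ?t x \<alpha> \<noteq> 0}"
  have lin: "linear_on scale scale UNIV (\<lambda>x. star x y)" "linear_on scale scale UNIV (star x)" for x y
    using bil unfolding bilinear_product_on_def by auto
  have lin_t: "linear_on scale (*) UNIV (\<lambda>x. ?t x \<gamma>)"
    using linear_to_series by (simp add: linear_on_def)
  have C: "?t (star (e \<alpha>) (e \<beta>)) \<gamma> = ?C \<alpha> \<beta> \<gamma>" for \<alpha> \<beta>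
    by (simp add: struct_const_def to_series_def)
  have right: "?t (star z y) \<gamma> = (\<Sum>\<beta>\<in>?S y. ?t y \<beta> * ?t (star z (e \<beta>)) \<gamma>)" for z
  proof -
    have "star z y = star z (\<Sum>\<beta>\<in>?S y. scale (?t y \<beta>) (e \<beta>))"
      by (rule arg_cong[OF basis_expansion])
    then show ?thesis by (simp only: linear_on_UNIV_sum[OF lin(2)] linear_on_UNIV_sum[OF lin_t])
  qed
  have "star x y = star (\<Sum>\<alpha>\<in>?S x. scale (?t x \<alpha>) (e \<alpha>)) y"
    by (rule arg_cong[OF basis_expansion])
  then have "?t (star x y) \<gamma> = (\<Sum>\<alpha>\<in>?S x. ?t x \<alpha> * ?t (star (e \<alpha>) y) \<gamma>)"
    by (simp only: linear_on_UNIV_sum[OF lin(1)] linear_on_UNIV_sum[OF lin_t])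
  also have "\<dots> = (\<Sum>\<alpha>\<in>?S x. \<Sum>\<beta>\<in>?S y. ?C \<alpha> \<beta> \<gamma> * (?t x \<alpha> * ?t y \<beta>))"
    unfolding right C by (simp add: sum_distrib_left mult_ac)
  also have "\<dots> = (\<Sum>(\<alpha>, \<beta>)\<in>?S x \<times> ?S y. ?C \<alpha> \<beta> \<gamma> * (?t x \<alpha> * ?t y \<beta>))"
    by (rule sum.cartesian_product)
  also have "\<dots> = (\<Sum>\<^sub>\<infinity>(\<alpha>, \<beta>)\<in>?S x \<times> ?S y. ?C \<alpha> \<beta> \<gamma> * (?t x \<alpha> * ?t y \<beta>))"
    by (rule infsum_finite[symmetric]) (intro finite_cartesian_product finite_support_to_series)
  also have "\<dots> = (\<Sum>\<^sub>\<infinity>(\<alpha>, \<beta>). ?C \<alpha> \<beta> \<gamma> * (?t x \<alpha> * ?t y \<beta>))"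
    by (rule infsum_cong_neutral) auto
  finally show "?t (star x y) \<gamma> = series_product ?C (?t x) (?t y) \<gamma>"
    unfolding series_product_def .
qed

end

theorem theorem2p6:
  fixes scale :: "complex \<Rightarrow> 'a::ab_group_add \<Rightarrow> 'a"
    and star :: "'a \<Rightarrow> 'a \<Rightarrow> 'a"
    and e :: "'i \<Rightarrow> 'a"
  assumes "vector_space scale"
    and "bilinear_product_on scale UNIV star"
    and "basis_family scale e"
    and "countable (UNIV :: 'i set)" and "infinite (UNIV :: 'i set)"
    and "nice_elements scale star e = UNIV"
  shows
    "topspace (series_topology (struct_const scale star e)) = nice_series (struct_const scale star e)
     \<and> is_completion scale (nice_topology scale star e)
         fun_scale (series_topology (struct_const scale star e)) (to_series scale e)
     \<and> (\<exists>star'. frechet_algebra fun_scale (series_topology (struct_const scale star e)) star' \<and>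
          (\<forall>x y. to_series scale e (star x y) = star' (to_series scale e x) (to_series scale e y)))
     \<and> (\<forall>U. openin (subtopology (product_topology (\<lambda>_. euclidean) UNIV)
                        (nice_series (struct_const scale star e))) U
            \<longrightarrow> openin (series_topology (struct_const scale star e)) U)
     \<and> (\<forall>\<alpha>. linear_on fun_scale (*) (nice_series (struct_const scale star e)) (\<lambda>a. a \<alpha>)
        \<and> continuous_map (series_topology (struct_const scale star e)) euclidean (\<lambda>a. a \<alpha>)
        \<and> (\<forall>x. (\<lambda>a. a \<alpha>) (to_series scale e x) = basis_coeff scale e \<alpha> x))
     \<and> unconditional_schauder_basis fun_scale (series_topology (struct_const scale star e))
        (\<lambda>\<alpha>. to_series scale e (e \<alpha>))
     \<and> (\<forall>a \<in> nice_series (struct_const scale star e).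
          converges_unconditionally (series_topology (struct_const scale star e))
            (\<lambda>\<alpha>. fun_scale (a \<alpha>) (to_series scale e (e \<alpha>))) a)"
proof -
  let ?C = "struct_const scale star e" and ?t = "to_series scale e"
  note vs = assms(1) and bil = assms(2) and basis = assms(3)
  have t_nice: "?t x \<in> nice_series ?C" for x
  proof -
    have "x \<in> nice_elements scale star e" using assms(6) by simp
    then show ?thesis unfolding nice_elements_def nice_series_def by simp
  qed
  have t_basis: "?t (e \<alpha>) = unit_series \<alpha>" for \<alpha> by (rule to_series_basis[OF vs basis])
  have unit_nice: "unit_series \<alpha> \<in> nice_series ?C" for \<alpha> using t_nice[of "e \<alpha>"] unfolding t_basis .
  have w: "weight ?C l \<gamma> \<alpha> < top" for l \<gamma> \<alpha> by (rule weight_finite_if_unit_series_nice[OF unit_nice])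
  have lin: "linear_on scale fun_scale UNIV ?t" by (rule linear_to_series[OF vs basis])
  have frechet: "frechet_space fun_scale (series_topology ?C)"
    by (rule frechet_space_series_topology[OF assms(4)])
  have "(\<lambda>p x. p (?t x)) ` series_seminorms ?C
      = {\<lambda>x. rnorm ?C m l \<gamma> (?t x) | m l \<gamma>. l < 2 ^ m}" (is "?L = ?R")
  proof (intro equalityI subsetI)
    fix q assume "q \<in> ?L"
    then obtain p where p: "p \<in> series_seminorms ?C" "q = (\<lambda>x. p (?t x))" by (rule imageE)
    from p(1) obtain m l \<gamma> where "l < 2 ^ m" "p = rnorm ?C m l \<gamma>" by (rule series_seminormsE)
    then show "q \<in> ?R" unfolding p(2) mem_Collect_eq by (intro exI conjI) (simp_all only:)
  next
    fix q assume "q \<in> ?R"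
    then obtain m l \<gamma> where "l < 2 ^ m" "q = (\<lambda>x. rnorm ?C m l \<gamma> (?t x))"
      unfolding mem_Collect_eq by (elim exE conjE)
    then show "q \<in> ?L" by (intro image_eqI[OF _ rnorm_in_series_seminorms])
  qed
  then have nice_top: "nice_topology scale star e = seminorm_topology UNIV ((\<lambda>p x. p (?t x)) ` series_seminorms ?C)"
    unfolding nice_topology_def assms(6) rnorm_def by (simp only:)
  have sub: "module.subspace scale UNIV"
  proof -
    interpret vector_space scale by (fact vs)
    show ?thesis by (rule subspace_UNIV)
  qed
  have into: "range ?t \<subseteq> nice_series ?C" using t_nice by blast
  have tvs1: "topological_vector_space scale (nice_topology scale star e)"
    unfolding nice_top
    by (rule seminorm_family.topological_vector_space[OF series.pullback[OF vs sub lin into]])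
  have emb: "embedding_map (nice_topology scale star e) (series_topology ?C) ?t"
    unfolding nice_top series_topology_eq
    by (rule series.embedding_pullback[OF vs sub lin into inj_to_series[OF vs basis]])
  have top1: "topspace (nice_topology scale star e) = UNIV"
    unfolding nice_top by (rule seminorm_family.topspace_T[OF series.pullback[OF vs sub lin into]])
  have expansion: "converges_unconditionally (series_topology ?C) (\<lambda>\<alpha>. fun_scale (a \<alpha>) (unit_series \<alpha>)) a"
    if "a \<in> nice_series ?C" for a by (rule unit_series_expansion[OF w that])
  have "series_topology ?C closure_of range ?t = topspace (series_topology ?C)"
  proof
    show "topspace (series_topology ?C) \<subseteq> series_topology ?C closure_of range ?t"
    proof
      fix a assume a: "a \<in> topspace (series_topology ?C)"
      then have lim: "limitin (series_topology ?C) (\<lambda>F. \<Sum>\<alpha>\<in>F. fun_scale (a \<alpha>) (unit_series \<alpha>)) a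
          (finite_subsets_at_top UNIV)"
        using expansion[of a] unfolding converges_unconditionally_def topspace_series_topology by simp
      show "a \<in> series_topology ?C closure_of range ?t"
        unfolding in_closure_of
      proof (intro conjI allI impI a)
        fix U assume "a \<in> U \<and> openin (series_topology ?C) U"
        then have "\<forall>\<^sub>F F in finite_subsets_at_top UNIV. (\<Sum>\<alpha>\<in>F. fun_scale (a \<alpha>) (unit_series \<alpha>)) \<in> U"
          using limitinD[OF lim, of U] by simp
        then obtain F where "(\<Sum>\<alpha>\<in>F. fun_scale (a \<alpha>) (unit_series \<alpha>)) \<in> U"
          using eventually_happens'[OF finite_subsets_at_top_neq_bot] by blast
        then show "\<exists>y. y \<in> range ?t \<and> y \<in> U"
          using sum_unit_series_in_range[OF vs basis] by blast
      qed
    qed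
  qed (rule closure_of_subset_topspace)
  then have completion: "is_completion scale (nice_topology scale star e) fun_scale (series_topology ?C) ?t"
    using frechet tvs1 emb lin metrizable_imp_Hausdorff_space
    unfolding is_completion_def frechet_space_def top1 by blast
  have "frechet_algebra fun_scale (series_topology ?C) (series_product ?C)"
    unfolding frechet_algebra_def topspace_series_topology
    using frechet bilinear_series_product continuous_series_product by blast
  then have algebra: "\<exists>star'. frechet_algebra fun_scale (series_topology ?C) star' \<and>
          (\<forall>x y. ?t (star x y) = star' (?t x) (?t y))"
    using to_series_product[OF vs basis bil] by blast
  show ?thesis
    unfolding t_basis
  proof (intro conjI allI impI ballI)
    show "topspace (series_topology ?C) = nice_series ?C" by (rule topspace_series_topology)
    show "is_completion scale (nice_topology scale star e) fun_scale (series_topology ?C) ?t" by (rule completion)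
    show "\<exists>star'. frechet_algebra fun_scale (series_topology ?C) star' \<and>
        (\<forall>x y. ?t (star x y) = star' (?t x) (?t y))" by (rule algebra)
    show "openin (series_topology ?C) U"
      if "openin (subtopology (product_topology (\<lambda>_. euclidean) UNIV) (nice_series ?C)) U" for U
      using that by (rule series_topology_finer_than_product)
    show "linear_on fun_scale (*) (nice_series ?C) (\<lambda>a. a \<alpha>)" for \<alpha> by (simp add: linear_on_def)
    show "continuous_map (series_topology ?C) euclidean (\<lambda>a. a \<alpha>)" for \<alpha> by (rule continuous_map_coordinate)
    show "?t x \<alpha> = basis_coeff scale e \<alpha> x" for \<alpha> x by (simp add: to_series_def)
    show "unconditional_schauder_basis fun_scale (series_topology ?C) unit_series"
      by (rule unit_series_unconditional_basis[OF w unit_nice])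
    show "converges_unconditionally (series_topology ?C) (\<lambda>\<alpha>. fun_scale (a \<alpha>) (unit_series \<alpha>)) a"
      if "a \<in> nice_series ?C" for a using that by (rule expansion)
  qed
qed

end
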